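(* Let $H$ be a complex Hilbert space, let $B\in B(H)$ and let $N,M$ be densely defined closable linear operators in $H$ (not necessarily bounded) such that their closures $\overline{N}$ and $\overline{M}$ are normal. If $BN\subset MB$, then \[BN^*\subset M^*B.\]
   Context: Operators in $H$ are linear, not necessarily bounded, and defined on a linear subspace (the domain $D(\cdot)$) of $H$; $B(H)$ denotes the bounded linear operators defined on all of $H$. $S\subset T$ means $D(S)\subset D(T)$ and $Sx=Tx$ for all $x\in D(S)$. The product $ST$ has domain $D(ST)=\{x\in D(T): Tx\in D(S)\}$. An operator is closed if its graph is closed in $H\oplus H$; it is closable if it has a closed extension, and its closure $\overline{T}$ is then its smallest closed extension. A densely defined operator $T$ is normal if it is closed and $TT^*=T^*T$ (with equality of domains). *)

theory Defs
  imports "HOL-Analysis.Analysis"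
begin

section \<open>Complex Hilbert spaces\<close>

text \<open>The complex inner product is linear in its first argument. A complex inner product space is
  presented on top of its underlying real inner product space, whose inner product is the real
  part of the complex one; thus norm, metric and topology are the ones induced by \<open>cinner\<close>, and
  positive definiteness is inherited from \<^class>\<open>real_inner\<close>.\<close>

class complex_inner = real_inner +
  fixes scaleC :: "complex \<Rightarrow> 'a \<Rightarrow> 'a"  (infixr \<open>*\<^sub>C\<close> 75)
    and cinner :: "'a \<Rightarrow> 'a \<Rightarrow> complex"
  assumes scaleC_add_right: "c *\<^sub>C (x + y) = c *\<^sub>C x + c *\<^sub>C y"
    and scaleC_add_left: "(c + d) *\<^sub>C x = c *\<^sub>C x + d *\<^sub>C x"
    and scaleC_scaleC: "c *\<^sub>C (d *\<^sub>C x) = (c * d) *\<^sub>C x"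
    and scaleC_one: "1 *\<^sub>C x = x"
    and scaleR_scaleC: "r *\<^sub>R x = complex_of_real r *\<^sub>C x"
    and cinner_commute: "cinner x y = cnj (cinner y x)"
    and cinner_add_left: "cinner (x + y) z = cinner x z + cinner y z"
    and cinner_scaleC_left: "cinner (c *\<^sub>C x) y = c * cinner x y"
    and Re_cinner: "Re (cinner x y) = inner x y"

class chilbert_space = complex_inner + banach

instantiation complex :: chilbert_space
begin

definition scaleC_complex :: "complex \<Rightarrow> complex \<Rightarrow> complex"
  where "scaleC_complex c x = c * x"

definition cinner_complex :: "complex \<Rightarrow> complex \<Rightarrow> complex"
  where "cinner_complex x y = x * cnj y"

instance
  by standard
    (auto simp: scaleC_complex_def cinner_complex_def algebra_simps inner_complex_def
      scaleR_conv_of_real)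

end

lemma cinner_self: "cinner x x = complex_of_real ((norm x)\<^sup>2)"
proof -
  have "Im (cinner x x) = 0"
    using arg_cong[OF cinner_commute[of x x], of Im] by simp
  then show ?thesis
    by (simp add: complex_eq_iff Re_cinner power2_norm_eq_inner)
qed

lemma norm_scaleC: "norm (c *\<^sub>C x) = cmod c * norm x"
proof -
  have "cinner (c *\<^sub>C x) (c *\<^sub>C x) = c * cnj (c * cinner x x)"
    by (metis cinner_commute cinner_scaleC_left)
  also have "\<dots> = complex_of_real ((cmod c * norm x)\<^sup>2)"
    by (simp add: cinner_self power_mult_distrib complex_norm_square mult.assoc [symmetric]
        del: of_real_power)
  finally have "(norm (c *\<^sub>C x))\<^sup>2 = (cmod c * norm x)\<^sup>2"
    unfolding cinner_self by (simp only: of_real_eq_iff)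
  then show ?thesis
    by simp
qed

lemma bounded_linear_scaleC: "bounded_linear (\<lambda>x. c *\<^sub>C x)"
  by (rule bounded_linear_intro[where K = "cmod c"])
    (auto simp: scaleC_add_right scaleR_scaleC scaleC_scaleC norm_scaleC mult.commute)

section \<open>Unbounded operators\<close>

text \<open>An operator with a domain is a partial function \<open>T\<close> whose domain is \<^term>\<open>dom T\<close>. With this
  encoding equality includes equality of domains, \<open>S \<subseteq>\<^sub>m T\<close> says that \<open>T\<close> extends \<open>S\<close>, and
  \<open>S \<circ>\<^sub>m T\<close> is defined exactly at those \<open>x\<close> in the domain of \<open>T\<close> for which \<open>T x\<close> lies in the
  domain of \<open>S\<close>.\<close>

text \<open>The first conjunct makes the domain nonempty; together the conjuncts say that
  the domain is a complex subspace on which \<open>T\<close> is linear.\<close>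

definition linear_op :: "('a::complex_inner \<rightharpoonup> 'a) \<Rightarrow> bool"
  where "linear_op T \<longleftrightarrow>
    T 0 = Some 0 \<and>
    (\<forall>x y u v. T x = Some u \<longrightarrow> T y = Some v \<longrightarrow> T (x + y) = Some (u + v)) \<and>
    (\<forall>c x u. T x = Some u \<longrightarrow> T (c *\<^sub>C x) = Some (c *\<^sub>C u))"

definition bounded_op :: "('a::complex_inner \<rightharpoonup> 'a) \<Rightarrow> bool"
  where "bounded_op B \<longleftrightarrow>
    linear_op B \<and> dom B = UNIV \<and> (\<exists>K. \<forall>x y. B x = Some y \<longrightarrow> norm y \<le> K * norm x)"

definition densely_defined :: "('a::complex_inner \<rightharpoonup> 'a) \<Rightarrow> bool"
  where "densely_defined T \<longleftrightarrow> closure (dom T) = UNIV"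

definition closed_op :: "('a::complex_inner \<rightharpoonup> 'a) \<Rightarrow> bool"
  where "closed_op T \<longleftrightarrow> linear_op T \<and> closed (Map.graph T)"

definition closable_op :: "('a::complex_inner \<rightharpoonup> 'a) \<Rightarrow> bool"
  where "closable_op T \<longleftrightarrow> (\<exists>S. closed_op S \<and> T \<subseteq>\<^sub>m S)"

text \<open>The smallest closed extension; meaningful for closable linear operators, see
  \<open>graph_closure_op\<close> below.\<close>

definition closure_op :: "('a::complex_inner \<rightharpoonup> 'a) \<Rightarrow> ('a \<rightharpoonup> 'a)"
  where "closure_op T =
    (THE S. closed_op S \<and> T \<subseteq>\<^sub>m S \<and> (\<forall>S'. closed_op S' \<longrightarrow> T \<subseteq>\<^sub>m S' \<longrightarrow> S \<subseteq>\<^sub>m S'))"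

text \<open>The Hilbert space adjoint; meaningful for densely defined operators, where the vector \<open>z\<close> is
  unique, see \<open>adjoint_op_eq_Some_iff\<close> below.\<close>

definition adjoint_op :: "('a::complex_inner \<rightharpoonup> 'a) \<Rightarrow> ('a \<rightharpoonup> 'a)"
  where "adjoint_op T y =
    (if \<exists>z. \<forall>x u. T x = Some u \<longrightarrow> cinner u y = cinner x z
     then Some (THE z. \<forall>x u. T x = Some u \<longrightarrow> cinner u y = cinner x z)
     else None)"

definition normal_op :: "('a::complex_inner \<rightharpoonup> 'a) \<Rightarrow> bool"
  where "normal_op T \<longleftrightarrow>
    densely_defined T \<and> closed_op T \<and> T \<circ>\<^sub>m adjoint_op T = adjoint_op T \<circ>\<^sub>m T"

section \<open>Well-definedness of adjoint and closure\<close>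

lemma adjoint_op_eq_Some_iff:
  assumes "densely_defined T"
  shows "adjoint_op T y = Some z \<longleftrightarrow> (\<forall>x u. T x = Some u \<longrightarrow> cinner u y = cinner x z)"
proof -
  have uniq: "z1 = z2"
    if 1: "\<forall>x u. T x = Some u \<longrightarrow> cinner u y = cinner x z1"
      and 2: "\<forall>x u. T x = Some u \<longrightarrow> cinner u y = cinner x z2" for z1 z2
  proof -
    have "dom T \<subseteq> {x. inner x (z1 - z2) = 0}"
    proof
      fix x assume "x \<in> dom T"
      then have "cinner x z1 = cinner x z2"
        using 1 2 by (metis domD)
      then show "x \<in> {x. inner x (z1 - z2) = 0}"
        by (simp add: inner_diff_right) (metis Re_cinner)
    qed
    moreover have "closed {x. inner x (z1 - z2) = 0}"
      by (intro closed_Collect_eq continuous_intros)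
    ultimately have "closure (dom T) \<subseteq> {x. inner x (z1 - z2) = 0}"
      by (rule closure_minimal)
    then have "inner (z1 - z2) (z1 - z2) = 0"
      using assms unfolding densely_defined_def by blast
    then show ?thesis
      by simp
  qed
  show ?thesis
  proof
    assume "adjoint_op T y = Some z"
    then obtain z' where z': "\<forall>x u. T x = Some u \<longrightarrow> cinner u y = cinner x z'"
      and z: "z = (THE z. \<forall>x u. T x = Some u \<longrightarrow> cinner u y = cinner x z)"
      by (auto simp: adjoint_op_def split: if_splits)
    have "(THE z. \<forall>x u. T x = Some u \<longrightarrow> cinner u y = cinner x z) = z'"
      using z' uniq by (intro the_equality) blast+
    with z z' show "\<forall>x u. T x = Some u \<longrightarrow> cinner u y = cinner x z"
      by simp
  next
    assume z: "\<forall>x u. T x = Some u \<longrightarrow> cinner u y = cinner x z"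
    have "(THE z. \<forall>x u. T x = Some u \<longrightarrow> cinner u y = cinner x z) = z"
      using z uniq by (intro the_equality) blast+
    with z show "adjoint_op T y = Some z"
      by (auto simp: adjoint_op_def)
  qed
qed

lemma graph_subset_iff: "Map.graph S \<subseteq> Map.graph T \<longleftrightarrow> S \<subseteq>\<^sub>m T"
proof
  assume sub: "Map.graph S \<subseteq> Map.graph T"
  have "T x = Some y" if "S x = Some y" for x y
    using sub that by (auto simp: Map.graph_def)
  then show "S \<subseteq>\<^sub>m T"
    by (auto simp: map_le_def)
next
  assume "S \<subseteq>\<^sub>m T"
  then have "T x = Some y" if "S x = Some y" for x y
    using that by (metis domI map_le_def)
  then show "Map.graph S \<subseteq> Map.graph T"
    by (auto simp: Map.graph_def)
qed

lemma linear_op_graph_iff: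
  "linear_op T \<longleftrightarrow>
    (0, 0) \<in> Map.graph T \<and>
    (\<forall>p\<in>Map.graph T. \<forall>q\<in>Map.graph T. p + q \<in> Map.graph T) \<and>
    (\<forall>c. \<forall>p\<in>Map.graph T. (c *\<^sub>C fst p, c *\<^sub>C snd p) \<in> Map.graph T)"
  unfolding linear_op_def Map.graph_def by auto

lemma closure_op_smallest:
  assumes "linear_op T" and "closable_op T"
  shows graph_closure_op: "Map.graph (closure_op T) = closure (Map.graph T)"
    and closed_op_closure_op: "closed_op (closure_op T)"
    and map_le_closure_op: "T \<subseteq>\<^sub>m closure_op T"
    and closure_op_minimal: "closed_op S \<Longrightarrow> T \<subseteq>\<^sub>m S \<Longrightarrow> closure_op T \<subseteq>\<^sub>m S"
proof -
  let ?G = "closure (Map.graph T)"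
  obtain R where R: "closed_op R" "T \<subseteq>\<^sub>m R"
    using assms(2) by (auto simp: closable_op_def)
  have sub: "?G \<subseteq> Map.graph S'" if "closed_op S'" "T \<subseteq>\<^sub>m S'" for S'
    using that by (intro closure_minimal) (auto simp: closed_op_def graph_subset_iff)
  have single: "y = z" if "(x, y) \<in> ?G" "(x, z) \<in> ?G" for x y z
    using that[THEN subsetD[OF sub[OF R]]] by (simp add: Map.graph_def)
  define C where "C x = (if \<exists>y. (x, y) \<in> ?G then Some (THE y. (x, y) \<in> ?G) else None)" for x
  have "C x = Some y \<longleftrightarrow> (x, y) \<in> ?G" for x y
    using single the_equality[of "\<lambda>y. (x, y) \<in> ?G"] unfolding C_def
    by (smt (verit, ccfv_threshold) option.distinct(1) option.inject)
  then have graph_C: "Map.graph C = ?G"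
    by (auto simp: Map.graph_def)
  have "p + q \<in> ?G" if "p \<in> ?G" "q \<in> ?G" for p q
  proof -
    obtain f g where "\<forall>n::nat. f n \<in> Map.graph T" "f \<longlonglongrightarrow> p" "\<forall>n::nat. g n \<in> Map.graph T" "g \<longlonglongrightarrow> q"
      using \<open>p \<in> ?G\<close> \<open>q \<in> ?G\<close> unfolding closure_sequential by blast
    then have "\<forall>n. f n + g n \<in> Map.graph T" "(\<lambda>n. f n + g n) \<longlonglongrightarrow> p + q"
      using assms(1) by (auto simp: linear_op_graph_iff intro: tendsto_add)
    then show ?thesis
      unfolding closure_sequential by (intro exI[of _ "\<lambda>n. f n + g n"]) simp
  qed
  moreover have "(c *\<^sub>C fst p, c *\<^sub>C snd p) \<in> ?G" if "p \<in> ?G" for p c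
  proof -
    obtain f where f: "\<forall>n::nat. f n \<in> Map.graph T" "f \<longlonglongrightarrow> p"
      using \<open>p \<in> ?G\<close> by (auto simp: closure_sequential)
    have "(\<lambda>n. (c *\<^sub>C fst (f n), c *\<^sub>C snd (f n))) \<longlonglongrightarrow> (c *\<^sub>C fst p, c *\<^sub>C snd p)"
      by (intro tendsto_Pair bounded_linear.tendsto[OF bounded_linear_scaleC] tendsto_fst tendsto_snd f)
    moreover have "\<forall>n. (c *\<^sub>C fst (f n), c *\<^sub>C snd (f n)) \<in> Map.graph T"
      using f(1) assms(1) by (auto simp: linear_op_graph_iff)
    ultimately show ?thesis
      unfolding closure_sequential by (intro exI[of _ "\<lambda>n. (c *\<^sub>C fst (f n), c *\<^sub>C snd (f n))"]) simp
  qed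
  moreover have "(0, 0) \<in> ?G"
    using assms(1) closure_subset by (auto simp: linear_op_graph_iff)
  ultimately have C: "closed_op C"
    unfolding closed_op_def linear_op_graph_iff graph_C by auto
  have T_C: "T \<subseteq>\<^sub>m C"
    using graph_C closure_subset by (metis graph_subset_iff)
  have min: "C \<subseteq>\<^sub>m S'" if "closed_op S'" "T \<subseteq>\<^sub>m S'" for S'
    using sub[OF that] graph_C by (metis graph_subset_iff)
  have eq: "closure_op T = C"
    unfolding closure_op_def
    by (rule the_equality) (use C T_C min in \<open>auto intro: map_le_antisym\<close>)
  show "Map.graph (closure_op T) = closure (Map.graph T)" "closed_op (closure_op T)"
    "T \<subseteq>\<^sub>m closure_op T" "closed_op S \<Longrightarrow> T \<subseteq>\<^sub>m S \<Longrightarrow> closure_op T \<subseteq>\<^sub>m S"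
    using eq graph_C C T_C min by auto
qed

end

theory Submission
  imports Defs "HOL-Complex_Analysis.Cauchy_Integral_Formula" "HOL-Computational_Algebra.Polynomial"
begin

text \<open>For bounded normal operators \<open>T\<close>, \<open>S\<close> with \<open>B T = S B\<close> Rosenblum's argument applies: the entire
  function \<open>exp(-s S\<^sup>*) B exp(s T\<^sup>*)\<close> equals \<open>U B V\<close> with \<open>U\<close> and \<open>V\<close> unitary, so it is bounded,
  hence constant, and its derivative \<open>B T\<^sup>* - S\<^sup>* B\<close> at \<open>0\<close> vanishes. For a closed normal operator \<open>T\<close> the
  bounded positive injective operator \<open>A = (1 + T\<^sup>* T)\<^sup>-\<^sup>1\<close> replaces the spectral theorem: \<open>T A\<close> and
  \<open>T\<^sup>* A\<close> are bounded, and the continuous functional calculus of \<open>A\<close> yields bounded \<open>P\<^sub>n\<close>, commuting with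
  \<open>T\<close> and tending strongly to \<open>1\<close>, such that \<open>T\<close> agrees on the range of \<open>P\<^sub>n\<close> with a bounded normal
  operator. If \<open>Q\<^sub>n\<close> are the corresponding cutoffs of \<open>M\<close> and \<open>P\<^sub>n\<close> those of \<open>N\<close>, the bounded theorem applies
  to \<open>Q\<^sub>n B P\<^sub>n\<close>, and letting \<open>n\<close> tend to infinity gives the claim.\<close>

section \<open>The theorem for bounded normal operators\<close>

lemma cinner_add_right: "cinner x (y + z) = cinner x y + cinner x z"
  by (subst (1 2 3) cinner_commute) (simp add: cinner_add_left)

lemma cinner_scaleC_right: "cinner x (c *\<^sub>C y) = cnj c * cinner x y"
  by (subst (1 2) cinner_commute) (simp add: cinner_scaleC_left)

lemma norm_cinner_le: "cmod (cinner x y) \<le> norm x * norm y"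
proof -
  \<comment> \<open>Multiplying \<open>x\<close> by this phase turns the complex inner product into
    its modulus, which is real, so the real Cauchy-Schwarz inequality applies.\<close>
  define c where "c = cnj (sgn (cinner x y))"
  have "cinner (c *\<^sub>C x) y = complex_of_real (cmod (cinner x y))"
    unfolding cinner_scaleC_left c_def sgn_div_norm scaleR_conv_of_real
    by (cases "cinner x y = 0")
      (auto simp: complex_norm_square[symmetric] field_simps power2_eq_square mult.commute[of "cnj _"])
  then have "cmod (cinner x y) = inner (c *\<^sub>C x) y"
    by (metis Re_complex_of_real Re_cinner)
  also have "\<dots> \<le> norm (c *\<^sub>C x) * norm y"
    by (rule norm_cauchy_schwarz)
  also have "\<dots> \<le> norm x * norm y"
    by (auto simp: norm_scaleC c_def norm_sgn)
  finally show ?thesis .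
qed

text \<open>Conjugate-linearity in the second argument is still linearity over the reals, which
  makes the limit and product rules for bounded bilinear maps available.\<close>

lemma bounded_bilinear_cinner: "bounded_bilinear (cinner :: 'a::complex_inner \<Rightarrow> _)"
proof
  show "\<exists>K. \<forall>a b::'a. norm (cinner a b) \<le> norm a * norm b * K"
    by (intro exI[of _ 1]) (simp add: norm_cinner_le)
qed (auto simp: cinner_add_left cinner_add_right scaleR_scaleC cinner_scaleC_left
    cinner_scaleC_right scaleC_complex_def)

lemma bounded_bilinear_scaleC: "bounded_bilinear ((*\<^sub>C) :: complex \<Rightarrow> 'a::complex_inner \<Rightarrow> 'a)"
proof
  show "\<exists>K. \<forall>a. \<forall>b::'a. norm (a *\<^sub>C b) \<le> norm a * norm b * K"
    by (intro exI[of _ 1]) (simp add: norm_scaleC)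
qed (auto simp: scaleC_add_left scaleC_add_right scaleR_scaleC scaleC_scaleC scaleC_complex_def mult.commute)

lemma cinner_eq_imp_eq:
  assumes "\<And>x. cinner x y = cinner x z" shows "y = z"
proof -
  have "inner (y - z) y = inner (y - z) z"
    by (metis assms Re_cinner)
  then have "inner (y - z) (y - z) = 0"
    by (simp add: inner_diff_right)
  then show ?thesis by simp
qed

definition bounded_clinear :: "('a::complex_inner \<Rightarrow> 'a) \<Rightarrow> bool"
  where "bounded_clinear T \<longleftrightarrow> bounded_linear T \<and> (\<forall>c x. T (c *\<^sub>C x) = c *\<^sub>C T x)"

lemma bounded_clinear_compose:
  "bounded_clinear S \<Longrightarrow> bounded_clinear T \<Longrightarrow> bounded_clinear (\<lambda>x. S (T x))"
  by (auto simp: bounded_clinear_def bounded_linear_compose)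

lemma norm_funpow_le:
  fixes T :: "'a::real_normed_vector \<Rightarrow> 'a"
  assumes "\<And>x. norm (T x) \<le> K * norm x" "0 \<le> K"
  shows "norm ((T ^^ n) x) \<le> K ^ n * norm x"
proof (induction n)
  case (Suc n)
  have "norm ((T ^^ Suc n) x) \<le> K * norm ((T ^^ n) x)"
    using assms(1) by simp
  also have "\<dots> \<le> K * (K ^ n * norm x)"
    using Suc assms(2) by (intro mult_left_mono)
  finally show ?case by simp
qed simp

lemma bounded_linear_funpow:
  fixes T :: "'a::real_normed_vector \<Rightarrow> 'a"
  assumes "bounded_linear T"
  shows "bounded_linear (T ^^ n)"
  by (induction n) (auto simp: o_def id_def intro: bounded_linear_ident bounded_linear_compose[OF assms])

lemma funpow_scaleC:
  fixes T :: "'a::complex_inner \<Rightarrow> 'a"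
  assumes "\<And>c x. T (c *\<^sub>C x) = c *\<^sub>C T x"
  shows "(T ^^ n) (c *\<^sub>C x) = c *\<^sub>C (T ^^ n) x"
  by (induction n) (auto simp: assms)

section \<open>Exponentials of bounded operators\<close>

text \<open>This is \<open>exp(s T) x\<close>, summed vector by vector, so that no norm on a space
  of operators is required.\<close>

definition cexp :: "('a::chilbert_space \<Rightarrow> 'a) \<Rightarrow> complex \<Rightarrow> 'a \<Rightarrow> 'a"
  where "cexp T s x = (\<Sum>n. (s ^ n / fact n) *\<^sub>C (T ^^ n) x)"

locale bounded_clinear_op =
  fixes T :: "'a::chilbert_space \<Rightarrow> 'a"
  assumes bounded_clinear: "bounded_clinear T"
begin

lemma bl: "bounded_linear T" and scaleC: "T (c *\<^sub>C x) = c *\<^sub>C T x"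
  using bounded_clinear by (auto simp: bounded_clinear_def)

definition K where "K = (SOME K. 0 < K \<and> (\<forall>x. norm (T x) \<le> K * norm x))"

lemma K: "0 < K" "norm (T x) \<le> K * norm x"
proof -
  have "\<exists>K. 0 < K \<and> (\<forall>x. norm (T x) \<le> K * norm x)"
    using bounded_linear.pos_bounded[OF bl] by (auto simp: mult.commute)
  from someI_ex[OF this] show "0 < K" "norm (T x) \<le> K * norm x"
    by (auto simp: K_def)
qed

lemma norm_term_le: "norm ((s ^ n / fact n) *\<^sub>C (T ^^ n) x) \<le> (cmod s * K) ^ n /\<^sub>R fact n * norm x"
proof -
  have "norm ((s ^ n / fact n) *\<^sub>C (T ^^ n) x) = cmod s ^ n / fact n * norm ((T ^^ n) x)"
    by (simp add: norm_scaleC norm_divide norm_power)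
  also have "\<dots> \<le> cmod s ^ n / fact n * (K ^ n * norm x)"
    using K by (intro mult_left_mono norm_funpow_le) auto
  finally show ?thesis by (simp add: field_simps power_mult_distrib)
qed

lemma exp_bound_sums: "(\<lambda>n. (cmod s * K) ^ n /\<^sub>R fact n * norm x) sums (exp (cmod s * K) * norm x)"
  by (intro sums_mult2 exp_converges)

lemma summable_norm_term: "summable (\<lambda>n. norm ((s ^ n / fact n) *\<^sub>C (T ^^ n) x))"
  by (rule summable_comparison_test'[OF sums_summable[OF exp_bound_sums[of s x]]])
    (use norm_term_le in auto)

lemma cexp_sums: "(\<lambda>n. (s ^ n / fact n) *\<^sub>C (T ^^ n) x) sums cexp T s x"
  unfolding cexp_def by (rule summable_sums[OF summable_norm_cancel[OF summable_norm_term]])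

text \<open>The unordered form of the series, for rearranging the double series in
  \<open>cexp_add\<close>.\<close>

lemma cexp_has_sum: "((\<lambda>n. (s ^ n / fact n) *\<^sub>C (T ^^ n) x) has_sum cexp T s x) UNIV"
  by (intro norm_summable_imp_has_sum summable_norm_term cexp_sums)

lemma cexp_0: "cexp T 0 x = x"
proof -
  have "(\<lambda>n. (0 ^ n / fact n) *\<^sub>C (T ^^ n) x) = (\<lambda>n. if n = 0 then x else 0)"
    by (auto simp: scaleC_one zero_power bounded_bilinear.zero_left[OF bounded_bilinear_scaleC] fun_eq_iff)
  with cexp_sums[of 0 x] have "(\<lambda>n. if n = 0 then x else 0) sums cexp T 0 x"
    by (simp only:)
  with sums_single[of 0 "\<lambda>_. x"] show ?thesis
    by (rule sums_unique2[symmetric])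
qed

lemma norm_cexp_le: "norm (cexp T s x) \<le> exp (cmod s * K) * norm x"
  using norm_suminf_le[OF norm_term_le sums_summable[OF exp_bound_sums], of s x]
  unfolding cexp_def sums_unique[OF exp_bound_sums, symmetric] .

text \<open>The double series \<open>f\<close> converges absolutely. Summed by rows it gives the
  composition; summed along antidiagonals it gives, by the binomial theorem, the exponential of
  \<open>s + t\<close>.\<close>

lemma cexp_add: "cexp T (s + t) x = cexp T s (cexp T t x)"
proof -
  define f where "f = (\<lambda>(i, j). (s ^ i / fact i * (t ^ j / fact j)) *\<^sub>C (T ^^ (i + j)) x)"
  have lin: "bounded_linear (\<lambda>x. (s ^ i / fact i) *\<^sub>C (T ^^ i) x)" for i
    by (intro bounded_linear_compose[OF bounded_linear_scaleC] bounded_linear_funpow bl)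
  have inner_sum: "((\<lambda>j. f (i, j)) has_sum ((s ^ i / fact i) *\<^sub>C (T ^^ i) (cexp T t x))) UNIV" for i
    using has_sum_bounded_linear[OF lin[of i] cexp_has_sum[of t x]]
    by (simp add: f_def o_def funpow_scaleC[of T, OF scaleC] scaleC_scaleC funpow_add)
  \<comment> \<open>The majorant is a product of two real exponential series.\<close>
  have "(\<lambda>p. (cmod s * K) ^ fst p /\<^sub>R fact (fst p) * ((cmod t * K) ^ snd p /\<^sub>R fact (snd p)) * norm x)
      summable_on UNIV \<times> UNIV"
  proof -
    have 1: "(\<lambda>n. r ^ n /\<^sub>R fact n) summable_on UNIV" if "0 \<le> r" for r :: real
      using that sums_nonneg_imp_has_sum[OF exp_converges[of r]] by (auto simp: summable_on_def)
    have "(\<lambda>(i, j). ((cmod s * K) ^ i /\<^sub>R fact i) * ((cmod t * K) ^ j /\<^sub>R fact j)) summable_on UNIV \<times> UNIV"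
    proof (rule summable_on_SigmaI)
      have "((\<lambda>j. (cmod t * K) ^ j /\<^sub>R fact j) has_sum exp (cmod t * K)) UNIV"
        using K(1) by (intro sums_nonneg_imp_has_sum exp_converges) auto
      then show "((\<lambda>j. case (i, j) of (i, j) \<Rightarrow> ((cmod s * K) ^ i /\<^sub>R fact i) * ((cmod t * K) ^ j /\<^sub>R fact j))
          has_sum ((cmod s * K) ^ i /\<^sub>R fact i) * exp (cmod t * K)) UNIV" for i
        unfolding prod.case by (rule has_sum_cmult_right)
      show "(\<lambda>i. ((cmod s * K) ^ i /\<^sub>R fact i) * exp (cmod t * K)) summable_on UNIV"
        using K(1) by (intro summable_on_cmult_left 1) auto
    qed (use K(1) in auto)
    then show ?thesis
      by (intro summable_on_cmult_left) (simp add: case_prod_unfold)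
  qed
  then have "(\<lambda>p. norm (f p)) summable_on UNIV \<times> UNIV"
  proof (rule summable_on_comparison_test)
    fix p :: "nat \<times> nat"
    obtain i j where p: "p = (i, j)" by force
    have "norm (f p) = cmod s ^ i / fact i * (cmod t ^ j / fact j) * norm ((T ^^ (i + j)) x)"
      by (simp add: p f_def norm_scaleC norm_divide norm_power norm_mult)
    also have "\<dots> \<le> cmod s ^ i / fact i * (cmod t ^ j / fact j) * (K ^ (i + j) * norm x)"
      using K by (intro mult_left_mono norm_funpow_le) auto
    finally show "norm (f p) \<le> (cmod s * K) ^ fst p /\<^sub>R fact (fst p) * ((cmod t * K) ^ snd p /\<^sub>R fact (snd p)) * norm x"
      by (simp add: p field_simps power_mult_distrib power_add)
  qed auto
  then have "f summable_on UNIV \<times> UNIV"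
    by (rule abs_summable_summable)
  then obtain L where L: "(f has_sum L) (UNIV \<times> UNIV)"
    by (auto simp: summable_on_def)
  have 1: "L = cexp T s (cexp T t x)"
    by (rule has_sum_unique[OF has_sum_SigmaD[OF L inner_sum] cexp_has_sum])
  \<comment> \<open>The pair \<open>(n, i)\<close> denotes the entry \<open>i\<close> on the
    antidiagonal of index sum \<open>n\<close>.\<close>
  have bij: "bij_betw (\<lambda>(n, i). (i, n - i)) (SIGMA n:UNIV. {..n}) (UNIV \<times> (UNIV :: nat set))"
    by (rule bij_betwI[of _ _ _ "\<lambda>(i, j). (i + j, i)"]) auto
  define g where "g = (\<lambda>p. f (snd p, fst p - snd p))"
  have g: "(g has_sum L) (SIGMA n:UNIV. {..n})"
    using has_sum_reindex_bij_betw[OF bij, of f L] L by (simp add: case_prod_unfold g_def)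
  have "((\<lambda>i. g (n, i)) has_sum (((s + t) ^ n / fact n) *\<^sub>C (T ^^ n) x)) {..n}" for n
  proof -
    have "(s + t) ^ n / fact n = (\<Sum>i\<le>n. s ^ i / fact i * (t ^ (n - i) / fact (n - i)))"
      unfolding binomial_ring sum_divide_distrib
      by (intro sum.cong refl) (auto simp: binomial_fact field_simps)
    then have "((s + t) ^ n / fact n) *\<^sub>C (T ^^ n) x = (\<Sum>i\<le>n. f (i, n - i))"
      by (simp add: f_def bounded_bilinear.sum_left[OF bounded_bilinear_scaleC])
    then show ?thesis
      by (simp add: has_sum_finite_iff g_def)
  qed
  then have "L = cexp T (s + t) x"
    by (intro has_sum_unique[OF has_sum_SigmaD[OF g] cexp_has_sum])
  with 1 show ?thesis by simp
qed

lemma cexp_minus_cancel: "cexp T s (cexp T (- s) x) = x"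
  using cexp_add[of s "- s" x] by (simp add: cexp_0)

text \<open>By \<open>cexp_add\<close> the increment at \<open>s\<close> is the increment at
  \<open>0\<close> applied to \<open>y = cexp T s x\<close>. The series from its quadratic term on
  is dominated by the same tail of the real exponential, which is at most \<open>r^2\<close> for
  \<open>0 <= r <= 1\<close>.\<close>

lemma cexp_has_derivative:
  "((\<lambda>s. cexp T s x) has_derivative (\<lambda>h. h *\<^sub>C T (cexp T s x))) (at s)"
proof -
  define y where "y = cexp T s x"
  have bound: "norm (cexp T h y - y - h *\<^sub>C T y) \<le> (cmod h * K)\<^sup>2 * norm y" if "cmod h * K \<le> 1" for h
  proof -
    let ?r = "cmod h * K"
    have *: "(\<lambda>n. (h ^ (n + 2) / fact (n + 2)) *\<^sub>C (T ^^ (n + 2)) y) sums (cexp T h y - y - h *\<^sub>C T y)"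
      using sums_split_initial_segment[OF cexp_sums[of h y], of 2]
      by (simp add: numeral_2_eq_2 scaleC_one diff_diff_eq)
    have **: "(\<lambda>n. ?r ^ (n + 2) /\<^sub>R fact (n + 2) * norm y) sums (exp ?r * norm y - norm y - ?r * norm y)"
      using sums_split_initial_segment[OF exp_bound_sums[of h y], of 2]
      by (simp add: numeral_2_eq_2 diff_diff_eq)
    have "norm (cexp T h y - y - h *\<^sub>C T y) \<le> exp ?r * norm y - norm y - ?r * norm y"
      using norm_suminf_le[OF norm_term_le sums_summable[OF **]]
      unfolding sums_unique[OF *, symmetric] sums_unique[OF **, symmetric] .
    also have "\<dots> = (exp ?r - 1 - ?r) * norm y"
      by (simp add: algebra_simps)
    also have "\<dots> \<le> ?r\<^sup>2 * norm y"
      using exp_bound[of ?r] that K(1) by (intro mult_right_mono) auto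
    finally show ?thesis .
  qed
  have "((\<lambda>h. norm (cexp T (s + h) x - cexp T s x - h *\<^sub>C T y) / norm h) \<longlongrightarrow> 0) (at 0)"
  proof (rule tendsto_sandwich[OF _ _ tendsto_const])
    show "((\<lambda>h::complex. cmod h * (K\<^sup>2 * norm y)) \<longlongrightarrow> 0) (at 0)"
      by (intro tendsto_mult_left_zero tendsto_norm_zero tendsto_ident_at)
    have "\<forall>\<^sub>F h::complex in at 0. cmod h < inverse K"
      using K(1) by (auto simp: eventually_at intro!: exI[of _ "inverse K"])
    then show "\<forall>\<^sub>F h in at 0. norm (cexp T (s + h) x - cexp T s x - h *\<^sub>C T y) / norm h \<le> cmod h * (K\<^sup>2 * norm y)"
    proof eventually_elim
      case (elim h)
      then have "cmod h * K \<le> 1"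
        using K(1) by (simp add: field_simps)
      then have "norm (cexp T (s + h) x - cexp T s x - h *\<^sub>C T y) \<le> (cmod h * K)\<^sup>2 * norm y"
        using bound[of h] by (simp add: add.commute[of s] cexp_add y_def)
      then show ?case
        by (cases "h = 0") (auto simp: field_simps power2_eq_square)
    qed
  qed auto
  moreover have "bounded_linear (\<lambda>h. h *\<^sub>C T y)"
    by (rule bounded_bilinear.bounded_linear_left[OF bounded_bilinear_scaleC])
  ultimately show ?thesis
    by (simp add: has_derivative_at y_def)
qed

end

text \<open>The relation passes to all powers and then termwise through the series, since
  \<open>C\<close> is continuous.\<close>

lemma cexp_intertwine:
  assumes "bounded_clinear S" "bounded_clinear T" "bounded_clinear C"
    and comm: "\<And>x. C (T x) = S (C x)"
  shows "C (cexp T s x) = cexp S s (C x)"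
proof -
  interpret S: bounded_clinear_op S by standard fact
  interpret T: bounded_clinear_op T by standard fact
  interpret C: bounded_clinear_op C by standard fact
  have "C ((T ^^ n) x) = (S ^^ n) (C x)" for n
    by (induction n) (auto simp: comm)
  then show ?thesis
    using bounded_linear.sums[OF C.bl T.cexp_sums[of s x]] S.cexp_sums[of s "C x"] sums_unique2
    by (auto simp: C.scaleC)
qed

lemma cexp_bounded_clinear:
  assumes "bounded_clinear T"
  shows "bounded_clinear (cexp T s)"
proof -
  interpret T: bounded_clinear_op T by standard fact
  have "cexp T s (x + y) = cexp T s x + cexp T s y" for x y
    using sums_add[OF T.cexp_sums[of s x] T.cexp_sums[of s y]] T.cexp_sums[of s "x + y"]
    by (simp add: scaleC_add_right[symmetric] linear_add[symmetric] bounded_linear.linear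
        bounded_linear_funpow T.bl sums_unique2)
  \<comment> \<open>Multiplication by \<open>c\<close> commutes with \<open>T\<close>, so
    homogeneity is an instance of intertwining.\<close>
  moreover have sc: "cexp T s (c *\<^sub>C x) = c *\<^sub>C cexp T s x" for c x
    using cexp_intertwine[OF assms assms, of "\<lambda>x. c *\<^sub>C x" s x]
    by (auto simp: bounded_clinear_def bounded_linear_scaleC T.scaleC scaleC_scaleC mult.commute)
  ultimately have "bounded_linear (cexp T s)"
    using T.norm_cexp_le[of s]
    by (intro bounded_linear_intro[where K = "exp (cmod s * T.K)"])
      (auto simp: scaleR_scaleC mult.commute[of "norm _"])
  with sc show ?thesis
    by (simp add: bounded_clinear_def)
qed

lemma cexp_commute:
  assumes "bounded_clinear S" "bounded_clinear T" "\<And>x. S (T x) = T (S x)"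
  shows "cexp S s (cexp T t x) = cexp T t (cexp S s x)"
proof -
  have "T (cexp S s x) = cexp S s (T x)" for x
    using assms by (intro cexp_intertwine) auto
  then show ?thesis
    using assms cexp_bounded_clinear by (intro cexp_intertwine) auto
qed

lemma cexp_adjoint:
  assumes "bounded_clinear T" "bounded_clinear T'"
    and adj: "\<And>x y. cinner (T x) y = cinner x (T' y)"
  shows "cinner (cexp T s x) y = cinner x (cexp T' (cnj s) y)"
proof -
  interpret T: bounded_clinear_op T by standard fact
  interpret T': bounded_clinear_op T' by standard fact
  have "cinner ((T ^^ n) x) y = cinner x ((T' ^^ n) y)" for n
    by (induction n arbitrary: y) (simp_all add: adj funpow_swap1[of T'])
  then show ?thesis
    using bounded_linear.sums[OF bounded_bilinear.bounded_linear_left[OF bounded_bilinear_cinner] T.cexp_sums[of s x], of y]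
      bounded_linear.sums[OF bounded_bilinear.bounded_linear_right[OF bounded_bilinear_cinner] T'.cexp_sums[of "cnj s" y], of x]
      sums_unique2 by (auto simp: cinner_scaleC_left cinner_scaleC_right)
qed

text \<open>For normal \<open>T\<close> the exponent \<open>s T\<^sup>* - cnj s T\<close> is skew-adjoint, so its exponential is unitary.\<close>

lemma cexp_isometry:
  assumes "bounded_clinear T" "bounded_clinear T'"
    and adj: "\<And>x y. cinner (T x) y = cinner x (T' y)"
    and comm: "\<And>x. T (T' x) = T' (T x)"
  shows "norm (cexp T (- cnj s) (cexp T' s x)) = norm x"
proof -
  interpret T: bounded_clinear_op T by standard fact
  interpret T': bounded_clinear_op T' by standard fact
  have adj': "cinner (T' x) y = cinner x (T y)" for x y
    by (subst cinner_commute) (simp add: adj[symmetric] cinner_commute[symmetric])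
  let ?u = "cexp T (- cnj s) (cexp T' s x)"
  have "cinner ?u ?u = cinner x (cexp T (cnj s) (cexp T' (- s) (cexp T (- cnj s) (cexp T' s x))))"
    by (simp add: cexp_adjoint[OF assms(1,2) adj] cexp_adjoint[OF assms(2,1) adj'])
  \<comment> \<open>Normality lets the four exponentials be reordered so that they cancel in
    pairs.\<close>
  also have "\<dots> = cinner x x"
    using T.cexp_minus_cancel T'.cexp_minus_cancel[of "- s"]
    by (simp add: cexp_commute[OF assms(2,1) comm[symmetric]])
  finally have "(norm ?u)\<^sup>2 = (norm x)\<^sup>2"
    unfolding cinner_self of_real_eq_iff .
  then show ?thesis by simp
qed

lemma fuglede_putnam_bounded:
  fixes B T T' S S' :: "'a::chilbert_space \<Rightarrow> 'a"
  assumes "bounded_clinear B" "bounded_clinear T" "bounded_clinear T'" "bounded_clinear S" "bounded_clinear S'"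
    and adjT: "\<And>x y. cinner (T x) y = cinner x (T' y)" and commT: "\<And>x. T (T' x) = T' (T x)"
    and adjS: "\<And>x y. cinner (S x) y = cinner x (S' y)" and commS: "\<And>x. S (S' x) = S' (S x)"
    and B: "\<And>x. B (T x) = S (B x)"
  shows "B (T' x) = S' (B x)"
proof -
  interpret B: bounded_clinear_op B by standard fact
  interpret T: bounded_clinear_op T by standard fact
  interpret T': bounded_clinear_op T' by standard fact
  interpret S: bounded_clinear_op S by standard fact
  interpret S': bounded_clinear_op S' by standard fact
  have adjS': "cinner (S' x) y = cinner x (S y)" for x y
    by (subst cinner_commute) (simp add: adjS[symmetric] cinner_commute[symmetric])
  have "cinner y (B (T' x)) = cinner y (S' (B x))" for y
  proof -
    \<comment> \<open>This is the matrix coefficient of \<open>exp(-s S') B exp(s T')\<close> at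
      \<open>x\<close> and \<open>y\<close>, with the left factor moved across the inner product.
      Being scalar, it is accessible to Liouville's theorem.\<close>
    define f where "f s = cinner (B (cexp T' s x)) (cexp S (- cnj s) y)" for s
    define f' where "f' s = cinner (B (T' (cexp T' s x))) (cexp S (- cnj s) y)
      - cinner (B (cexp T' s x)) (S (cexp S (- cnj s) y))" for s
    have f': "(f has_field_derivative f' s) (at s)" for s
    proof -
      have 1: "((\<lambda>s. B (cexp T' s x)) has_derivative (\<lambda>h. h *\<^sub>C B (T' (cexp T' s x)))) (at s)"
        using bounded_linear.has_derivative[OF B.bl T'.cexp_has_derivative]
        by (simp add: B.scaleC)
      have "((\<lambda>s. - cnj s) has_derivative (\<lambda>h. - cnj h)) (at s)"
        by (intro derivative_intros bounded_linear.has_derivative[OF bounded_linear_cnj])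
      from has_derivative_compose[OF this S.cexp_has_derivative]
      have 2: "((\<lambda>s. cexp S (- cnj s) y) has_derivative (\<lambda>h. (- cnj h) *\<^sub>C S (cexp S (- cnj s) y))) (at s)" .
      \<comment> \<open>The inner map \<open>- cnj s\<close> is only real differentiable, but the
        conjugation in the second argument of \<open>cinner\<close> undoes it: the derivative is
        complex-linear in \<open>h\<close>.\<close>
      have "(f has_derivative (\<lambda>h. h * f' s)) (at s)"
        using bounded_bilinear.FDERIV[OF bounded_bilinear_cinner 1 2]
        unfolding f_def[abs_def]
        by (simp add: cinner_scaleC_left cinner_scaleC_right f'_def algebra_simps)
      then show ?thesis
        unfolding has_field_derivative_def by (rule has_derivative_eq_rhs) (auto simp: mult.commute)
    qed
    then have "f holomorphic_on UNIV"
      by (auto simp: holomorphic_on_def field_differentiable_def intro: has_field_derivative_at_within)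
    moreover have "bounded (range f)"
    proof (rule boundedI)
      fix z assume "z \<in> range f"
      then obtain s where z: "z = f s" by auto
      \<comment> \<open>Since \<open>B\<close> carries \<open>exp(cnj s T)\<close> to
        \<open>exp(cnj s S)\<close>, those factors can be shifted to turn \<open>f s\<close> into
        \<open>cinner (B u) v\<close>, where \<open>u\<close> and \<open>v\<close> are isometric
        images of \<open>x\<close> and \<open>y\<close>.\<close>
      define u where "u = cexp T (- cnj s) (cexp T' s x)"
      define v where "v = cexp S' s (cexp S (- cnj s) y)"
      have u: "norm u = norm x"
        unfolding u_def using assms by (intro cexp_isometry) auto
      have v: "norm v = norm y"
        using cexp_isometry[OF assms(5,4) adjS' commS[symmetric], of "- cnj s" y] by (simp add: v_def)
      have "cexp T' s x = cexp T (cnj s) u"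
        using T.cexp_minus_cancel[of "cnj s"] by (simp add: u_def)
      then have "f s = cinner (cexp S (cnj s) (B u)) (cexp S (- cnj s) y)"
        by (simp add: f_def cexp_intertwine[OF assms(4,2,1) B])
      also have "\<dots> = cinner (B u) v"
        by (simp add: cexp_adjoint[OF assms(4,5) adjS] v_def)
      also have "cmod \<dots> \<le> norm (B u) * norm v"
        by (rule norm_cinner_le)
      also have "\<dots> \<le> B.K * norm x * norm y"
        using B.K(2)[of u] by (simp add: u v mult_right_mono)
      finally show "norm z \<le> B.K * norm x * norm y" by (simp add: z)
    qed
    ultimately obtain c where "\<And>s. f s = c"
      using Liouville_theorem by (metis UNIV_I constant_on_def)
    then have "f = (\<lambda>s. c)" by auto
    then have "f' 0 = 0"
      using f'[of 0] DERIV_unique[OF _ DERIV_const] by auto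
    then have "cinner (B (T' x)) y = cinner (S' (B x)) y"
      by (simp add: f'_def T'.cexp_0 S.cexp_0 adjS')
    then show ?thesis
      by (metis cinner_commute)
  qed
  then show ?thesis by (rule cinner_eq_imp_eq)
qed

section \<open>Continuous functional calculus of a positive contraction\<close>

text \<open>Midpoints stay in \<open>S\<close>, so the parallelogram law makes a minimizing sequence
  for the distance Cauchy. Its limit is a nearest point, and the residual at a nearest point is
  orthogonal to \<open>S\<close>.\<close>

lemma orthogonal_projection_exists:
  fixes S :: "'a::{real_inner, banach} set"
  assumes "closed S" and "0 \<in> S" and add: "\<And>x y. x \<in> S \<Longrightarrow> y \<in> S \<Longrightarrow> x + y \<in> S"
    and scale: "\<And>(r::real) x. x \<in> S \<Longrightarrow> r *\<^sub>R x \<in> S"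
  obtains p where "p \<in> S" "\<And>s. s \<in> S \<Longrightarrow> inner (x - p) s = 0"
proof -
  define d where "d = infdist x S"
  have "S \<noteq> {}" using assms by auto
  have d_le: "d \<le> norm (x - s)" if "s \<in> S" for s
    using infdist_le[OF that, of x] by (simp add: d_def dist_norm)
  have d0: "0 \<le> d" by (simp add: d_def infdist_nonneg)
  have "\<exists>s\<in>S. norm (x - s) < d + inverse (Suc n)" for n
  proof (rule ccontr)
    assume "\<not> ?thesis"
    then have "d + inverse (Suc n) \<le> infdist x S"
      using \<open>S \<noteq> {}\<close> by (auto simp: infdist_def dist_norm not_less intro!: cINF_greatest)
    then show False by (simp add: d_def)
  qed
  then obtain s where s: "\<And>n. s n \<in> S" and sd: "\<And>n. norm (x - s n) < d + inverse (Suc n)"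
    by metis
  have "(\<lambda>n. d + inverse (real (Suc n))) \<longlonglongrightarrow> d + 0"
    by (intro tendsto_intros LIMSEQ_inverse_real_of_nat)
  then have u: "(\<lambda>n. d + inverse (real (Suc n))) \<longlonglongrightarrow> d" by simp
  have par: "(norm (s m - s n))\<^sup>2 \<le> 2 * (norm (x - s m))\<^sup>2 + 2 * (norm (x - s n))\<^sup>2 - 4 * d\<^sup>2" for m n
  proof -
    have "(1/2) *\<^sub>R (s m + s n) \<in> S" using s add scale by blast
    then have "d\<^sup>2 \<le> (norm (x - (1/2) *\<^sub>R (s m + s n)))\<^sup>2"
      using d0 d_le by (intro power_mono) auto
    also have "\<dots> = (norm ((1/2) *\<^sub>R ((x - s m) + (x - s n))))\<^sup>2"
      by (simp add: algebra_simps scaleR_left_distrib[symmetric])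
    also have "\<dots> = (norm ((x - s m) + (x - s n)))\<^sup>2 / 4"
      by (simp add: power_mult_distrib power2_eq_square)
    finally have "4 * d\<^sup>2 \<le> (norm ((x - s m) + (x - s n)))\<^sup>2" by simp
    moreover have "(norm ((x - s m) + (x - s n)))\<^sup>2 + (norm ((x - s n) - (x - s m)))\<^sup>2
        = 2 * (norm (x - s m))\<^sup>2 + 2 * (norm (x - s n))\<^sup>2"
      by (simp add: power2_norm_eq_inner inner_add_left inner_add_right inner_diff_left inner_diff_right inner_commute)
    ultimately show ?thesis by simp
  qed
  have "Cauchy s"
  proof (rule metric_CauchyI)
    fix e :: real assume "e > 0"
    have "(\<lambda>n. 4 * (d + inverse (real (Suc n)))\<^sup>2 - 4 * d\<^sup>2) \<longlonglongrightarrow> 4 * d\<^sup>2 - 4 * d\<^sup>2"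
      by (intro tendsto_intros u)
    then have "\<forall>\<^sub>F n in sequentially. 4 * (d + inverse (real (Suc n)))\<^sup>2 - 4 * d\<^sup>2 < e\<^sup>2"
      by (rule order_tendstoD) (use \<open>e > 0\<close> in auto)
    then obtain N where N: "\<And>n. n \<ge> N \<Longrightarrow> 4 * (d + inverse (real (Suc n)))\<^sup>2 - 4 * d\<^sup>2 < e\<^sup>2"
      by (auto simp: eventually_sequentially)
    have sq: "(norm (x - s n))\<^sup>2 \<le> (d + inverse (real (Suc N)))\<^sup>2" if "n \<ge> N" for n
    proof (rule power_mono)
      have "inverse (real (Suc n)) \<le> inverse (real (Suc N))"
        using that by (intro le_imp_inverse_le) auto
      then show "norm (x - s n) \<le> d + inverse (real (Suc N))"
        using sd[of n] by linarith
    qed simp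
    have "dist (s m) (s n) < e" if "m \<ge> N" "n \<ge> N" for m n
    proof -
      have "(norm (s m - s n))\<^sup>2 < e\<^sup>2"
        using par[of m n] sq[OF that(1)] sq[OF that(2)] N[of N] by linarith
      then show ?thesis
        using \<open>e > 0\<close> by (simp add: dist_norm power_less_imp_less_base)
    qed
    then show "\<exists>M. \<forall>m\<ge>M. \<forall>n\<ge>M. dist (s m) (s n) < e" by blast
  qed
  then obtain p where p: "s \<longlonglongrightarrow> p"
    by (auto simp: Cauchy_convergent_iff convergent_def)
  have pS: "p \<in> S"
    using closed_sequentially[OF \<open>closed S\<close> s p] .
  have "(\<lambda>n. norm (x - s n)) \<longlonglongrightarrow> norm (x - p)"
    by (intro tendsto_intros p)
  then have pd: "norm (x - p) \<le> d"
    using u sd by (intro LIMSEQ_le[OF _ u]) (auto intro: less_imp_le)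
  have "inner (x - p) t = 0" if t: "t \<in> S" for t
  proof (cases "t = 0")
    case False
    define a where "a = inner (x - p) t"
    \<comment> \<open>The multiple \<open>c\<close> of \<open>t\<close> is the one nearest to
      \<open>x - p\<close>; adding it to \<open>p\<close> would come strictly closer to
      \<open>x\<close> unless \<open>a = 0\<close>.\<close>
    define c where "c = a / inner t t"
    have "p + c *\<^sub>R t \<in> S" using pS t add scale by blast
    then have "(norm (x - p))\<^sup>2 \<le> (norm (x - (p + c *\<^sub>R t)))\<^sup>2"
      using pd d_le by (intro power_mono) (auto intro: order_trans)
    also have "\<dots> = (norm (x - p))\<^sup>2 - 2 * c * a + c\<^sup>2 * inner t t"
      unfolding power2_norm_eq_inner a_def
      by (simp add: inner_add_left inner_add_right inner_diff_left inner_diff_right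
          inner_commute power2_eq_square[of c] algebra_simps)
    also have "c\<^sup>2 * inner t t = c * a"
      using False by (simp add: c_def power2_eq_square)
    finally have "c * a \<le> 0" by linarith
    moreover have "c * a = a\<^sup>2 / inner t t" by (simp add: c_def power2_eq_square)
    moreover have "inner t t > 0" using False by simp
    ultimately have "a\<^sup>2 \<le> 0" by (simp add: divide_le_0_iff)
    then show ?thesis by (simp add: a_def)
  qed simp
  with pS show thesis by (rule that)
qed

lemma subspace_closure:
  fixes S :: "'a::real_normed_vector set"
  assumes "subspace S"
  shows "subspace (closure S)"
proof (rule subspaceI)
  show "0 \<in> closure S"
    using subspace_0[OF assms] closure_subset by blast
next
  fix x y assume "x \<in> closure S" "y \<in> closure S"
  then obtain f g where "\<forall>n. f n \<in> S" "f \<longlonglongrightarrow> x" "\<forall>n. g n \<in> S" "g \<longlonglongrightarrow> y"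
    unfolding closure_sequential by blast
  then show "x + y \<in> closure S"
    unfolding closure_sequential
    by (intro exI[of _ "\<lambda>n. f n + g n"]) (auto intro: tendsto_add subspace_add assms)
next
  fix c :: real and x assume "x \<in> closure S"
  then obtain f where "\<forall>n. f n \<in> S" "f \<longlonglongrightarrow> x"
    unfolding closure_sequential by blast
  then show "c *\<^sub>R x \<in> closure S"
    unfolding closure_sequential
    by (intro exI[of _ "\<lambda>n. c *\<^sub>R f n"]) (auto intro: tendsto_scaleR subspace_mul assms)
qed

section \<open>Bernstein coefficients of nonnegative polynomials\<close>

lemma smult_sum_right: "smult c (\<Sum>i\<in>I. f i) = (\<Sum>i\<in>I. smult c (f i))"
  by (induction I rule: infinite_finite_induct) (auto simp: smult_add_right)

text \<open>The product is the quotient of the falling factorials of \<open>k\<close> and \<open>n\<close>, which is close to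
  \<open>(k / n)\<^sup>j\<close> for large \<open>n\<close>. Hence the Bernstein coefficients of a polynomial that is nonnegative on
  the unit interval are nonnegative up to an arbitrarily small error.\<close>

lemma bernstein_monomial:
  assumes "j \<le> n"
  shows "monom 1 j = (\<Sum>k\<le>n. smult ((\<Prod>i<j. (real k - real i) / (real n - real i)) * real (n choose k))
           ([:0, 1:] ^ k * [:1, -1:] ^ (n - k)))"
proof -
  let ?X = "[:0, 1:] :: real poly" and ?Y = "[:1, -1:] :: real poly"
  have ff: "(\<Prod>i<j. real m - real i) = fact j * real (m choose j)" for m
    by (simp add: binomial_gbinomial gbinomial_prod_rev lessThan_atLeast0)
  \<comment> \<open>These are the coefficients that appear when \<open>X ^ j\<close> is multiplied
    by the expansion of \<open>(X + Y) ^ (n - j) = 1\<close>.\<close>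
  have coef: "(\<Prod>i<j. (real k - real i) / (real n - real i)) * real (n choose k)
      = (if k < j then 0 else real ((n - j) choose (k - j)))" if "k \<le> n" for k
  proof -
    have "(\<Prod>i<j. (real k - real i) / (real n - real i)) * real (n choose k)
        = real ((n choose k) * (k choose j)) / real (n choose j)"
      by (simp add: prod_dividef ff)
    also have "\<dots> = (if k < j then 0 else real ((n - j) choose (k - j)))"
    proof (cases "k < j")
      case False
      then have "(n choose k) * (k choose j) = (n choose j) * ((n - j) choose (k - j))"
        using that by (intro choose_mult) auto
      then show ?thesis
        using False assms by (simp del: of_nat_mult) simp
    qed (simp add: binomial_eq_0)
    finally show ?thesis .
  qed
  have "?X + ?Y = 1" by (simp add: one_pCons)
  then have "monom 1 j = ?X ^ j * (?X + ?Y) ^ (n - j)"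
    by (simp only: monom_altdef smult_1_left power_one mult_1_right)
  also have "\<dots> = (\<Sum>m\<le>n - j. ?X ^ j * (of_nat ((n - j) choose m) * ?X ^ m * ?Y ^ (n - j - m)))"
    by (simp only: binomial_ring sum_distrib_left)
  also have "\<dots> = (\<Sum>m\<le>n - j. smult (real ((n - j) choose m)) (?X ^ (m + j) * ?Y ^ (n - (m + j))))"
    by (intro sum.cong refl) (simp add: power_add of_nat_poly algebra_simps)
  also have "\<dots> = (\<Sum>k\<in>{j..n}. smult (real ((n - j) choose (k - j))) (?X ^ k * ?Y ^ (n - k)))"
    by (rule sum.reindex_bij_witness[of _ "\<lambda>k. k - j" "\<lambda>m. m + j"]) (use assms in auto)
  also have "\<dots> = (\<Sum>k\<le>n. smult (if k < j then 0 else real ((n - j) choose (k - j))) (?X ^ k * ?Y ^ (n - k)))"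
    by (rule sum.mono_neutral_cong_left) auto
  also have "\<dots> = (\<Sum>k\<le>n. smult ((\<Prod>i<j. (real k - real i) / (real n - real i)) * real (n choose k))
           (?X ^ k * ?Y ^ (n - k)))"
    by (intro sum.cong refl) (simp only: coef atMost_iff)
  finally show ?thesis .
qed

text \<open>Induction on \<open>j\<close>: the new factor differs from \<open>k / n\<close> by at
  most \<open>j / (n - j)\<close>, and both factors have modulus at most \<open>1\<close>, so the
  errors add up uniformly in \<open>k\<close>.\<close>

lemma falling_quotient_approx:
  assumes "(e::real) > 0"
  shows "\<exists>N. \<forall>n\<ge>N. \<forall>k\<le>n. \<bar>(\<Prod>i<j. (real k - real i) / (real n - real i)) - (real k / real n) ^ j\<bar> \<le> e"
  using assms
proof (induction j arbitrary: e)
  case (Suc j)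
  obtain N where N: "\<And>n k. n \<ge> N \<Longrightarrow> k \<le> n \<Longrightarrow>
      \<bar>(\<Prod>i<j. (real k - real i) / (real n - real i)) - (real k / real n) ^ j\<bar> \<le> e / 2"
    using Suc.IH[of "e / 2"] Suc.prems by auto
  obtain N' where N': "real N' \<ge> 2 * real j / e" using real_arch_simple by blast
  show ?case
  proof (intro exI allI impI)
    \<comment> \<open>The summand \<open>2 * j\<close> keeps the modulus of \<open>q\<close> at most
      \<open>1\<close> even when \<open>k < j\<close>; \<open>N'\<close> makes
      \<open>j / (n - j)\<close> at most \<open>e / 2\<close>.\<close>
    fix n k assume n: "n \<ge> max N (N' + 2 * j + 1)" and k: "k \<le> n"
    define q where "q = (real k - real j) / (real n - real j)"
    define a where "a = (\<Prod>i<j. (real k - real i) / (real n - real i))"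
    define t where "t = real k / real n"
    have nj: "real n - real j > 0" using n by auto
    have t: "0 \<le> t" "t \<le> 1" using k by (auto simp: t_def divide_le_eq_1)
    have "t - q = real j * (1 - t) / (real n - real j)"
      using nj by (simp add: t_def q_def field_simps)
    then have "\<bar>t - q\<bar> = real j * (1 - t) / (real n - real j)"
      using nj t by simp
    also have "\<dots> \<le> real j / (real n - real j)"
      using nj t by (intro divide_right_mono mult_left_le) auto
    also have "\<dots> \<le> e / 2"
    proof -
      have "2 * real j / e \<le> real n - real j" using N' n by linarith
      then show ?thesis using nj Suc.prems by (simp add: field_simps)
    qed
    finally have tq: "\<bar>t - q\<bar> \<le> e / 2" .
    have "\<bar>real k - real j\<bar> \<le> real n - real j"
      using n k by (simp add: abs_le_iff)
    then have q: "\<bar>q\<bar> \<le> 1" using nj by (simp add: q_def)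
    have "a * q - t ^ Suc j = (a - t ^ j) * q + t ^ j * (q - t)"
      by (simp add: algebra_simps)
    then have "\<bar>a * q - t ^ Suc j\<bar> \<le> \<bar>a - t ^ j\<bar> * \<bar>q\<bar> + \<bar>t ^ j\<bar> * \<bar>q - t\<bar>"
      by (metis abs_mult abs_triangle_ineq)
    also have "\<dots> \<le> e / 2 * 1 + 1 * (e / 2)"
    proof (intro add_mono mult_mono)
      show "\<bar>a - t ^ j\<bar> \<le> e / 2" unfolding a_def t_def using N n k by simp
      show "\<bar>t ^ j\<bar> \<le> 1" using t by (simp add: power_le_one)
    qed (use q tq Suc.prems in \<open>auto simp: abs_minus_commute\<close>)
    finally show "\<bar>(\<Prod>i<Suc j. (real k - real i) / (real n - real i)) - (real k / real n) ^ Suc j\<bar> \<le> e"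
      by (simp add: a_def q_def t_def)
  qed
qed auto

text \<open>By linearity from the monomials, the coefficient \<open>b k\<close> lies within
  \<open>e\<close> of the value of \<open>p\<close> at \<open>k / n\<close>, which is
  nonnegative.\<close>

lemma bernstein_almost_nonneg:
  fixes p :: "real poly"
  assumes nonneg: "\<And>t. 0 \<le> t \<Longrightarrow> t \<le> 1 \<Longrightarrow> 0 \<le> poly p t" and "e > 0"
  shows "\<exists>n b. (\<forall>k\<le>n. - e \<le> b k) \<and>
    p = (\<Sum>k\<le>n. smult (b k * real (n choose k)) ([:0, 1:] ^ k * [:1, -1:] ^ (n - k)))"
proof -
  define C where "C = (\<Sum>j\<le>degree p. \<bar>coeff p j\<bar>) + 1"
  have C: "C > 0" by (simp add: C_def add_nonneg_pos sum_nonneg)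
  define q where "q n k j = (\<Prod>i<j. (real k - real i) / (real n - real i))" for n k j
  have "\<exists>N. \<forall>n\<ge>N. \<forall>k\<le>n. \<bar>q n k j - (real k / real n) ^ j\<bar> \<le> e / C" for j
    using falling_quotient_approx[of "e / C" j] C \<open>e > 0\<close> by (simp add: q_def)
  then obtain N where N: "\<And>j n k. n \<ge> N j \<Longrightarrow> k \<le> n \<Longrightarrow> \<bar>q n k j - (real k / real n) ^ j\<bar> \<le> e / C"
    by metis
  \<comment> \<open>One \<open>n\<close> has to serve all monomials of \<open>p\<close>: it exceeds
    every threshold \<open>N j\<close>, and it is at least \<open>degree p\<close>, as
    \<open>bernstein_monomial\<close> demands.\<close>
  define n where "n = Max (N ` {..degree p}) + degree p"
  have n: "N j \<le> n" if "j \<le> degree p" for j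
    using that by (auto simp: n_def intro!: trans_le_add1 Max_ge)
  define b where "b k = (\<Sum>j\<le>degree p. coeff p j * q n k j)" for k
  show ?thesis
  proof (intro exI conjI allI impI)
    fix k assume k: "k \<le> n"
    have "\<bar>b k - poly p (real k / real n)\<bar> = \<bar>\<Sum>j\<le>degree p. coeff p j * (q n k j - (real k / real n) ^ j)\<bar>"
      by (simp add: b_def poly_altdef sum_subtractf right_diff_distrib)
    also have "\<dots> \<le> (\<Sum>j\<le>degree p. \<bar>coeff p j\<bar> * (e / C))"
      using N[OF n k] by (intro sum_abs[THEN order_trans] sum_mono) (simp add: abs_mult mult_left_mono del: times_divide_eq_right)
    also have "\<dots> = (C - 1) * (e / C)"
      unfolding sum_distrib_right[symmetric] by (simp add: C_def)
    also have "\<dots> \<le> e"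
      using C \<open>e > 0\<close> by (simp add: field_simps)
    finally have "\<bar>b k - poly p (real k / real n)\<bar> \<le> e" .
    moreover have "0 \<le> poly p (real k / real n)"
      using k by (intro nonneg) (auto simp: divide_le_eq_1)
    ultimately show "- e \<le> b k" by linarith
  next
    have "p = (\<Sum>j\<le>degree p. smult (coeff p j) (monom 1 j))"
      by (simp add: smult_monom poly_as_sum_of_monoms)
    also have "\<dots> = (\<Sum>j\<le>degree p. \<Sum>k\<le>n. smult (coeff p j * (q n k j * real (n choose k)))
           ([:0, 1:] ^ k * [:1, -1:] ^ (n - k)))"
    proof (intro sum.cong refl)
      fix j assume "j \<in> {..degree p}"
      then have "j \<le> n" by (simp add: n_def)
      then show "smult (coeff p j) (monom 1 j) = (\<Sum>k\<le>n. smult (coeff p j * (q n k j * real (n choose k)))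
           ([:0, 1:] ^ k * [:1, -1:] ^ (n - k)))"
        by (simp add: bernstein_monomial[of j n] smult_sum_right q_def)
    qed
    also have "\<dots> = (\<Sum>k\<le>n. \<Sum>j\<le>degree p. smult (coeff p j * (q n k j * real (n choose k)))
           ([:0, 1:] ^ k * [:1, -1:] ^ (n - k)))"
      by (rule sum.swap)
    also have "\<dots> = (\<Sum>k\<le>n. smult (b k * real (n choose k)) ([:0, 1:] ^ k * [:1, -1:] ^ (n - k)))"
      by (simp add: b_def smult_sum sum_distrib_right mult.assoc)
    finally show "p = (\<Sum>k\<le>n. smult (b k * real (n choose k)) ([:0, 1:] ^ k * [:1, -1:] ^ (n - k)))" .
  qed
qed

section \<open>Polynomials of a positive contraction\<close>

definition poly_op :: "('a::real_normed_vector \<Rightarrow> 'a) \<Rightarrow> real poly \<Rightarrow> 'a \<Rightarrow> 'a"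
  where "poly_op A p x = (\<Sum>i\<le>degree p. coeff p i *\<^sub>R (A ^^ i) x)"

text \<open>The two bounds on the quadratic form express that the spectrum of the symmetric operator
  \<open>A\<close> lies in the unit interval.\<close>

locale positive_contraction =
  fixes A :: "'a::{real_inner, banach} \<Rightarrow> 'a"
  assumes bl: "bounded_linear A"
    and sym: "inner (A x) y = inner x (A y)"
    and nonneg: "0 \<le> inner (A x) x"
    and le_one: "inner (A x) x \<le> inner x x"
begin

lemma lin: "linear A"
  using bl by (rule bounded_linear.linear)

lemma poly_op_eq_sum: "degree p \<le> n \<Longrightarrow> poly_op A p x = (\<Sum>i\<le>n. coeff p i *\<^sub>R (A ^^ i) x)"
  unfolding poly_op_def by (rule sum.mono_neutral_left) (auto simp: coeff_eq_0)

lemma poly_op_0 [simp]: "poly_op A 0 x = 0"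
  by (simp add: poly_op_def)

lemma poly_op_pCons [simp]: "poly_op A (pCons a p) x = a *\<^sub>R x + A (poly_op A p x)"
proof -
  have "poly_op A (pCons a p) x = (\<Sum>i\<le>Suc (degree p). coeff (pCons a p) i *\<^sub>R (A ^^ i) x)"
    by (rule poly_op_eq_sum) (rule degree_pCons_le)
  also have "\<dots> = a *\<^sub>R x + (\<Sum>i\<le>degree p. coeff p i *\<^sub>R A ((A ^^ i) x))"
    by (subst sum.atMost_Suc_shift) simp
  finally show ?thesis
    by (simp add: poly_op_def linear_sum[OF lin] linear_scale[OF lin])
qed

lemma poly_op_1 [simp]: "poly_op A 1 x = x"
  using poly_op_pCons[of 1 0 x] by (simp add: one_pCons linear_0[OF lin] del: poly_op_pCons)

lemma poly_op_add: "poly_op A (p + q) x = poly_op A p x + poly_op A q x"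
  by (induction p q rule: poly_induct2) (auto simp: linear_add[OF lin] scaleR_add_left)

lemma poly_op_smult: "poly_op A (smult c p) x = c *\<^sub>R poly_op A p x"
  by (induction p) (auto simp: linear_scale[OF lin] scaleR_add_right)

lemma poly_op_diff: "poly_op A (p - q) x = poly_op A p x - poly_op A q x"
  using poly_op_add[of p "smult (-1) q" x] poly_op_smult[of "-1" q x] by simp

lemma poly_op_sum: "poly_op A (sum p I) x = (\<Sum>i\<in>I. poly_op A (p i) x)"
  by (induction I rule: infinite_finite_induct) (auto simp: poly_op_add)

lemma poly_op_mult: "poly_op A (p * q) x = poly_op A p (poly_op A q x)"
  by (induction p) (auto simp: mult_pCons_left poly_op_add poly_op_smult)

lemma poly_op_bounded_linear: "bounded_linear (poly_op A p)"
proof (induction p)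
  case (pCons a p)
  then show ?case
    unfolding poly_op_pCons[abs_def]
    by (intro bounded_linear_add bounded_linear_scaleR_right bounded_linear_compose[OF bl])
qed (simp add: poly_op_0[abs_def])

lemma poly_op_commute:
  assumes "linear C" "\<And>x. C (A x) = A (C x)"
  shows "C (poly_op A p x) = poly_op A p (C x)"
  by (induction p) (auto simp: linear_add[OF assms(1)] linear_scale[OF assms(1)] linear_0[OF assms(1)] assms(2))

lemma poly_op_sym: "inner (poly_op A p x) y = inner x (poly_op A p y)"
proof (induction p arbitrary: x y)
  case (pCons a p)
  then show ?case
    using poly_op_commute[of A p y] lin by (auto simp: inner_add_left inner_add_right sym)
qed auto

text \<open>Symmetry moves one factor \<open>q\<close> to the other side, so positivity of
  \<open>r(A)\<close> is inherited by \<open>q(A) r(A) q(A)\<close>.\<close>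

lemma poly_op_power_even: "inner (poly_op A (q * q * r) x) x = inner (poly_op A r (poly_op A q x)) (poly_op A q x)"
proof -
  have "inner (poly_op A (q * (r * q)) x) x = inner (poly_op A r (poly_op A q x)) (poly_op A q x)"
    by (simp only: poly_op_mult poly_op_sym)
  then show ?thesis by (simp only: mult.assoc mult.commute[of r])
qed

text \<open>Removing even powers with \<open>poly_op_power_even\<close> leaves exponents
  \<open>0\<close> and \<open>1\<close>; of the four remaining products only \<open>X * Y\<close>
  needs an argument.\<close>

lemma poly_op_bernstein_nonneg: "0 \<le> inner (poly_op A ([:0, 1:] ^ k * [:1, -1:] ^ l) x) x"
proof -
  let ?X = "[:0, 1:] :: real poly" and ?Y = "[:1, -1:] :: real poly"
  have X: "0 \<le> inner (poly_op A ?X x) x" for x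
    by (simp add: nonneg linear_0[OF lin])
  have Y: "0 \<le> inner (poly_op A ?Y x) x" for x
    using le_one[of x] by (simp add: inner_diff_left linear_0[OF lin] linear_neg[OF lin])
  have XY: "0 \<le> inner (poly_op A (?X * ?Y) x) x" for x
  proof -
    have "?X * ?Y = ?X * ?X * ?Y + ?Y * ?Y * ?X" by simp \<comment> \<open>since \<open>X + Y = 1\<close>\<close>
    then have "inner (poly_op A (?X * ?Y) x) x = inner (poly_op A (?X * ?X * ?Y) x) x + inner (poly_op A (?Y * ?Y * ?X) x) x"
      by (simp only: poly_op_add inner_add_left)
    also have "\<dots> = inner (poly_op A ?Y (poly_op A ?X x)) (poly_op A ?X x) + inner (poly_op A ?X (poly_op A ?Y x)) (poly_op A ?Y x)"
      by (simp only: poly_op_power_even)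
    finally show ?thesis
      using X[of "poly_op A ?Y x"] Y[of "poly_op A ?X x"] by linarith
  qed
  define q where "q = ?X ^ (k div 2) * ?Y ^ (l div 2)"
  have split: "z ^ m = z ^ (m div 2) * z ^ (m div 2) * z ^ (m mod 2)" for z :: "real poly" and m
    by (metis power_add div_mult_mod_eq mult_2_right)
  have eq: "?X ^ k * ?Y ^ l = q * q * (?X ^ (k mod 2) * ?Y ^ (l mod 2))"
    unfolding q_def by (subst split[of ?X k], subst split[of ?Y l]) (simp only: ac_simps)
  have "0 \<le> inner (poly_op A (?X ^ (k mod 2) * ?Y ^ (l mod 2)) y) y" for y
  proof -
    have "k mod 2 = 0 \<or> k mod 2 = 1" "l mod 2 = 0 \<or> l mod 2 = 1" by auto
    then show ?thesis using X[of y] Y[of y] XY[of y]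
      by (elim disjE) (simp_all only: power_0 power_one_right mult_1_left mult_1_right poly_op_1 inner_ge_zero)
  qed
  then show ?thesis
    unfolding eq poly_op_power_even by blast
qed

text \<open>The Bernstein operators are positive and, weighted by binomial coefficients, sum to the
  identity. Coefficients at least \<open>- e\<close> therefore give the lower bound
  \<open>- e * inner x x\<close>; then \<open>e\<close> tends to \<open>0\<close>.\<close>

lemma poly_op_nonneg:
  assumes "\<And>t. 0 \<le> t \<Longrightarrow> t \<le> 1 \<Longrightarrow> 0 \<le> poly p t"
  shows "0 \<le> inner (poly_op A p x) x"
proof -
  have lower: "- e * inner x x \<le> inner (poly_op A p x) x" if "e > 0" for e
  proof -
    from assms that obtain n b where b: "\<And>k. k \<le> n \<Longrightarrow> - e \<le> b k"
      and p: "p = (\<Sum>k\<le>n. smult (b k * real (n choose k)) ([:0, 1:] ^ k * [:1, -1:] ^ (n - k)))"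
      using bernstein_almost_nonneg[of p e] by blast
    define w where "w k = real (n choose k) * inner (poly_op A ([:0, 1:] ^ k * [:1, -1:] ^ (n - k)) x) x" for k
    have one: "1 = (\<Sum>k\<le>n. smult (real (n choose k)) ([:0, 1:] ^ k * [:1, -1:] ^ (n - k)))"
      using bernstein_monomial[of 0 n] by simp
    have "inner x x = (\<Sum>k\<le>n. w k)"
      using arg_cong[OF one, of "\<lambda>p. inner (poly_op A p x) x"]
      by (simp only: w_def poly_op_1 poly_op_sum poly_op_smult inner_sum_left inner_scaleR_left)
    then have "- e * inner x x = (\<Sum>k\<le>n. - e * w k)"
      by (simp add: sum_distrib_left)
    also have "\<dots> \<le> (\<Sum>k\<le>n. b k * w k)"
      using b by (intro sum_mono mult_right_mono) (auto simp: w_def poly_op_bernstein_nonneg)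
    also have "\<dots> = inner (poly_op A p x) x"
      unfolding p by (simp add: poly_op_sum poly_op_smult inner_sum_left w_def mult.assoc)
    finally show ?thesis .
  qed
  then have "0 \<le> inner (poly_op A p x) x + e * inner x x" if "e > 0" for e
    using lower[OF that] by simp
  moreover have "((\<lambda>e. inner (poly_op A p x) x + e * inner x x) \<longlongrightarrow> inner (poly_op A p x) x + 0 * inner x x) (at_right 0)"
    by (intro tendsto_intros)
  ultimately have "0 \<le> inner (poly_op A p x) x + 0 * inner x x"
    by (intro tendsto_lowerbound[of _ _ "at_right (0::real)"]) (auto simp: eventually_at_filter)
  then show ?thesis by simp
qed

text \<open>Positivity of \<open>M^2 - p^2\<close> on the unit interval is applied to its operator,
  whose quadratic form is the difference of the squared norms.\<close>

lemma norm_poly_op_le: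
  assumes "\<And>t. 0 \<le> t \<Longrightarrow> t \<le> 1 \<Longrightarrow> \<bar>poly p t\<bar> \<le> M"
  shows "norm (poly_op A p x) \<le> M * norm x"
proof -
  have M: "0 \<le> M" using assms[of 0] by simp
  have "0 \<le> inner (poly_op A ([:M\<^sup>2:] - p * p) x) x"
  proof (rule poly_op_nonneg)
    fix t :: real assume "0 \<le> t" "t \<le> 1"
    then have "\<bar>poly p t\<bar>\<^sup>2 \<le> M\<^sup>2" using assms by (intro power_mono) auto
    then show "0 \<le> poly ([:M\<^sup>2:] - p * p) t" by (simp add: power2_eq_square)
  qed
  then have "(norm (poly_op A p x))\<^sup>2 \<le> (M * norm x)\<^sup>2"
    by (simp add: poly_op_diff poly_op_mult inner_diff_left poly_op_sym power2_norm_eq_inner power_mult_distrib linear_0[OF lin])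
  then show ?thesis by (rule power2_le_imp_le) (use M in simp)
qed

section \<open>Continuous functions of a positive contraction\<close>

definition weierstrass_poly :: "(real \<Rightarrow> real) \<Rightarrow> nat \<Rightarrow> real poly"
  where "weierstrass_poly f n = (SOME p. \<forall>t\<in>{0..1}. \<bar>f t - poly p t\<bar> \<le> inverse (Suc n))"

lemma weierstrass_poly:
  assumes "continuous_on {0..1} f" "0 \<le> t" "t \<le> 1"
  shows "\<bar>f t - poly (weierstrass_poly f n) t\<bar> \<le> inverse (Suc n)"
proof -
  obtain g where g: "real_polynomial_function g" "\<And>t. t \<in> {0..1} \<Longrightarrow> \<bar>f t - g t\<bar> < inverse (Suc n)"
    using Stone_Weierstrass_real_polynomial_function[OF compact_Icc assms(1), of "inverse (Suc n)"] by auto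
  obtain a m where "g = (\<lambda>x. \<Sum>i\<le>m. a i * x ^ i)"
    using g(1) real_polynomial_function_iff_sum by blast
  then have "g x = poly (\<Sum>i\<le>m. monom (a i) i) x" for x
    by (simp add: poly_sum poly_monom)
  with g(2) have "\<exists>p. \<forall>t\<in>{0..1}. \<bar>f t - poly p t\<bar> \<le> inverse (Suc n)"
    by (intro exI[of _ "\<Sum>i\<le>m. monom (a i) i"]) (simp add: less_imp_le)
  from someI_ex[OF this] show ?thesis
    using assms(2,3) by (auto simp: weierstrass_poly_def)
qed

definition cont_calc :: "(real \<Rightarrow> real) \<Rightarrow> 'a \<Rightarrow> 'a"
  where "cont_calc f x = lim (\<lambda>n. poly_op A (weierstrass_poly f n) x)"

text \<open>By \<open>norm_poly_op_le\<close>, uniform closeness of the approximating polynomials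
  makes their values at \<open>x\<close> a Cauchy sequence.\<close>

lemma cont_calc_tendsto:
  assumes f: "continuous_on {0..1} f"
  shows "(\<lambda>n. poly_op A (weierstrass_poly f n) x) \<longlonglongrightarrow> cont_calc f x"
proof -
  have "Cauchy (\<lambda>n. poly_op A (weierstrass_poly f n) x)"
  proof (rule metric_CauchyI)
    fix e :: real assume "e > 0"
    have "(\<lambda>n. 2 * inverse (real (Suc n)) * norm x) \<longlonglongrightarrow> 2 * 0 * norm x"
      by (intro tendsto_intros LIMSEQ_inverse_real_of_nat)
    then have "\<forall>\<^sub>F n in sequentially. 2 * inverse (real (Suc n)) * norm x < e"
      by (rule order_tendstoD) (use \<open>e > 0\<close> in auto)
    then obtain N where N: "2 * inverse (real (Suc N)) * norm x < e"
      by (auto simp: eventually_sequentially)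
    have "dist (poly_op A (weierstrass_poly f m) x) (poly_op A (weierstrass_poly f n) x) < e" if "m \<ge> N" "n \<ge> N" for m n
    proof -
      have "norm (poly_op A (weierstrass_poly f m - weierstrass_poly f n) x) \<le> 2 * inverse (real (Suc N)) * norm x"
      proof (rule norm_poly_op_le)
        fix t :: real assume t: "0 \<le> t" "t \<le> 1"
        have "inverse (real (Suc m)) \<le> inverse (real (Suc N))" "inverse (real (Suc n)) \<le> inverse (real (Suc N))"
          using that by (auto intro: le_imp_inverse_le)
        then show "\<bar>poly (weierstrass_poly f m - weierstrass_poly f n) t\<bar> \<le> 2 * inverse (real (Suc N))"
          using weierstrass_poly[OF f t, of m] weierstrass_poly[OF f t, of n] unfolding poly_diff by linarith
      qed
      then show ?thesis using N by (simp add: dist_norm poly_op_diff)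
    qed
    then show "\<exists>M. \<forall>m\<ge>M. \<forall>n\<ge>M. dist (poly_op A (weierstrass_poly f m) x) (poly_op A (weierstrass_poly f n) x) < e" by blast
  qed
  then show ?thesis
    unfolding cont_calc_def using Cauchy_convergent_iff convergent_LIMSEQ_iff by blast
qed

text \<open>This takes the place of multiplicativity for continuous functions. With
  \<open>q = 1\<close>, \<open>r = 0\<close> it gives the norm bound; \<open>q = r = X\<close> gives
  convergence of the cutoffs; \<open>q = X * r\<close> gives the inversion of \<open>A\<close> on
  their ranges.\<close>

lemma norm_cont_calc_poly_op_diff_le:
  assumes f: "continuous_on {0..1} f"
    and bound: "\<And>t. 0 \<le> t \<Longrightarrow> t \<le> 1 \<Longrightarrow> \<bar>f t * poly q t - poly r t\<bar> \<le> e"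
  shows "norm (cont_calc f (poly_op A q x) - poly_op A r x) \<le> e * norm x"
proof -
  have "bounded (poly q ` {0..1})"
    by (intro compact_imp_bounded compact_continuous_image continuous_intros compact_Icc)
  then obtain C where "\<forall>y\<in>poly q ` {0..1}. norm y \<le> C"
    unfolding bounded_iff by blast
  then have C: "\<And>t. 0 \<le> t \<Longrightarrow> t \<le> 1 \<Longrightarrow> \<bar>poly q t\<bar> \<le> C"
    by simp
  have "norm (poly_op A (weierstrass_poly f n) (poly_op A q x) - poly_op A r x) \<le> (e + C * inverse (real (Suc n))) * norm x" for n
  proof -
    have "norm (poly_op A (weierstrass_poly f n * q - r) x) \<le> (e + C * inverse (real (Suc n))) * norm x"
    proof (rule norm_poly_op_le)
      fix t :: real assume t: "0 \<le> t" "t \<le> 1"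
      have "poly (weierstrass_poly f n * q - r) t = (f t * poly q t - poly r t) - poly q t * (f t - poly (weierstrass_poly f n) t)"
        by (simp add: algebra_simps)
      also have "\<bar>\<dots>\<bar> \<le> \<bar>f t * poly q t - poly r t\<bar> + \<bar>poly q t\<bar> * \<bar>f t - poly (weierstrass_poly f n) t\<bar>"
        by (metis abs_mult abs_triangle_ineq4)
      also have "\<dots> \<le> e + C * inverse (real (Suc n))"
        using bound[OF t] C[OF t] weierstrass_poly[OF f t, of n] by (intro add_mono mult_mono) auto
      finally show "\<bar>poly (weierstrass_poly f n * q - r) t\<bar> \<le> e + C * inverse (real (Suc n))" .
    qed
    then show ?thesis by (simp add: poly_op_diff poly_op_mult)
  qed
  moreover have "(\<lambda>n. (e + C * inverse (real (Suc n))) * norm x) \<longlonglongrightarrow> (e + C * 0) * norm x"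
    by (intro tendsto_intros LIMSEQ_inverse_real_of_nat)
  moreover have "(\<lambda>n. norm (poly_op A (weierstrass_poly f n) (poly_op A q x) - poly_op A r x)) \<longlonglongrightarrow> norm (cont_calc f (poly_op A q x) - poly_op A r x)"
    by (intro tendsto_intros cont_calc_tendsto f)
  ultimately show ?thesis
    by (metis (no_types, lifting) LIMSEQ_le add.right_neutral mult_zero_right)
qed

lemma norm_cont_calc_le:
  assumes "continuous_on {0..1} f" "\<And>t. 0 \<le> t \<Longrightarrow> t \<le> 1 \<Longrightarrow> \<bar>f t\<bar> \<le> e"
  shows "norm (cont_calc f x) \<le> e * norm x"
  using norm_cont_calc_poly_op_diff_le[of f 1 0 e x] assms by simp

lemma cont_calc_bounded_linear:
  assumes f: "continuous_on {0..1} f"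
  shows "bounded_linear (cont_calc f)"
proof -
  have "bounded (f ` {0..1})"
    using f by (intro compact_imp_bounded compact_continuous_image compact_Icc)
  then obtain C where "\<forall>y\<in>f ` {0..1}. norm y \<le> C"
    unfolding bounded_iff by blast
  then have C: "\<And>t. 0 \<le> t \<Longrightarrow> t \<le> 1 \<Longrightarrow> \<bar>f t\<bar> \<le> C"
    by simp
  have lp: "linear (poly_op A p)" for p
    by (rule bounded_linear.linear[OF poly_op_bounded_linear])
  show ?thesis
  proof (rule bounded_linear_intro[where K = C])
    fix x y
    have "(\<lambda>n. poly_op A (weierstrass_poly f n) (x + y)) \<longlonglongrightarrow> cont_calc f x + cont_calc f y"
      unfolding linear_add[OF lp] by (intro tendsto_add cont_calc_tendsto f)
    then show "cont_calc f (x + y) = cont_calc f x + cont_calc f y"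
      using cont_calc_tendsto[OF f] LIMSEQ_unique by blast
  next
    fix r :: real and x
    have "(\<lambda>n. poly_op A (weierstrass_poly f n) (r *\<^sub>R x)) \<longlonglongrightarrow> r *\<^sub>R cont_calc f x"
      unfolding linear_scale[OF lp] by (intro tendsto_scaleR tendsto_const cont_calc_tendsto f)
    then show "cont_calc f (r *\<^sub>R x) = r *\<^sub>R cont_calc f x"
      using cont_calc_tendsto[OF f] LIMSEQ_unique by blast
  next
    show "norm (cont_calc f x) \<le> norm x * C" for x
      using norm_cont_calc_le[OF f C, of x] by (simp add: mult.commute)
  qed
qed

lemma cont_calc_sym:
  assumes f: "continuous_on {0..1} f"
  shows "inner (cont_calc f x) y = inner x (cont_calc f y)"
proof -
  have "(\<lambda>n. inner (poly_op A (weierstrass_poly f n) x) y) \<longlonglongrightarrow> inner (cont_calc f x) y"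
    by (intro tendsto_intros cont_calc_tendsto f)
  moreover have "(\<lambda>n. inner (poly_op A (weierstrass_poly f n) x) y) \<longlonglongrightarrow> inner x (cont_calc f y)"
    unfolding poly_op_sym by (intro tendsto_intros cont_calc_tendsto f)
  ultimately show ?thesis by (rule LIMSEQ_unique)
qed

lemma cont_calc_commute:
  assumes f: "continuous_on {0..1} f" and C: "bounded_linear C" "\<And>x. C (A x) = A (C x)"
  shows "C (cont_calc f x) = cont_calc f (C x)"
proof -
  have "(\<lambda>n. C (poly_op A (weierstrass_poly f n) x)) \<longlonglongrightarrow> C (cont_calc f x)"
    by (intro bounded_linear.tendsto[OF C(1)] cont_calc_tendsto f)
  then have "(\<lambda>n. poly_op A (weierstrass_poly f n) (C x)) \<longlonglongrightarrow> C (cont_calc f x)"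
    by (simp add: poly_op_commute[OF bounded_linear.linear[OF C(1)] C(2)])
  then show ?thesis using cont_calc_tendsto[OF f] LIMSEQ_unique by blast
qed

section \<open>Cutoffs away from the spectral value zero\<close>

text \<open>The residual of the projection of \<open>x\<close> onto the closed range is orthogonal
  to the range, hence annihilated by the symmetric \<open>A\<close>, hence zero.\<close>

lemma closure_range:
  assumes inj: "\<And>x. A x = 0 \<Longrightarrow> x = 0"
  shows "closure (range A) = UNIV"
proof -
  have sub: "subspace (range A)"
    by (rule linear_subspace_image[OF lin subspace_UNIV])
  have "x \<in> closure (range A)" for x
  proof -
    obtain p where p: "p \<in> closure (range A)" "\<And>s. s \<in> closure (range A) \<Longrightarrow> inner (x - p) s = 0"
      using orthogonal_projection_exists[OF closed_closure subspace_0 subspace_add subspace_mul]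
        subspace_closure[OF sub] by blast
    have "inner (A (x - p)) y = 0" for y
      using p(2)[of "A y"] closure_subset[of "range A"] by (auto simp: sym)
    then have "A (x - p) = 0"
      by (metis inner_eq_zero_iff)
    then show ?thesis using inj[of "x - p"] p(1) by simp
  qed
  then show ?thesis by auto
qed

text \<open>\<open>P n = f(A)\<close> and \<open>G n = g(A)\<close> with \<open>f\<close> supported in \<open>{c..}\<close>, equal to \<open>1\<close> on \<open>{2 * c..}\<close>, and
  \<open>t * g t = 1\<close> on the support of \<open>f\<close>, where \<open>c = 1 / (n + 1)\<close>.\<close>

lemma spectral_cutoffs:
  assumes inj: "\<And>x. A x = 0 \<Longrightarrow> x = 0"
  obtains P G :: "nat \<Rightarrow> 'a \<Rightarrow> 'a"
  where "\<And>n. bounded_linear (P n)" "\<And>n. bounded_linear (G n)"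
    "\<And>n x y. inner (P n x) y = inner x (P n y)" "\<And>n x y. inner (G n x) y = inner x (G n y)"
    "\<And>n C x. bounded_linear C \<Longrightarrow> (\<And>x. C (A x) = A (C x)) \<Longrightarrow> C (P n x) = P n (C x)"
    "\<And>n C x. bounded_linear C \<Longrightarrow> (\<And>x. C (A x) = A (C x)) \<Longrightarrow> C (G n x) = G n (C x)"
    "\<And>n x. G n (A (P n x)) = P n x" "\<And>x. (\<lambda>n. P n x) \<longlonglongrightarrow> x"
proof -
  define c where "c n = inverse (real (Suc n))" for n
  have c: "c n > 0" for n by (simp add: c_def)
  define f where "f n t = max 0 (min 1 (t / c n - 1))" for n t
  define g where "g n t = 1 / max t (c n)" for n t
  have f: "continuous_on {0..1} (f n)" for n
    unfolding f_def using c[of n] by (intro continuous_intros) auto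
  have g: "continuous_on {0..1} (g n)" for n
    unfolding g_def using c[of n] by (intro continuous_intros) (auto simp: max_def)
  have f1: "\<bar>f n t\<bar> \<le> 1" for n t by (auto simp: f_def)
  show thesis
  proof
    fix n x
    let ?P = "\<lambda>k. poly_op A (weierstrass_poly (f n) k) x"
    have GA: "bounded_linear (\<lambda>x. cont_calc (g n) (A x))"
      by (rule bounded_linear_compose[OF cont_calc_bounded_linear[OF g] bl])
    \<comment> \<open>For \<open>t >= c n\<close> the factor \<open>t * g n t\<close> is exactly
      \<open>1\<close>; below \<open>c n\<close> the function \<open>f n\<close> vanishes, so its
      approximating polynomial is itself within the error.\<close>
    have "norm (cont_calc (g n) (A (?P k)) - ?P k) \<le> inverse (Suc k) * norm x" for k
    proof -
      have "norm (cont_calc (g n) (poly_op A ([:0, 1:] * weierstrass_poly (f n) k) x) - ?P k) \<le> inverse (Suc k) * norm x"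
      proof (rule norm_cont_calc_poly_op_diff_le[OF g])
        fix t :: real assume t: "0 \<le> t" "t \<le> 1"
        show "\<bar>g n t * poly ([:0, 1:] * weierstrass_poly (f n) k) t - poly (weierstrass_poly (f n) k) t\<bar> \<le> inverse (Suc k)"
        proof (cases "t \<ge> c n")
          case True
          then show ?thesis using c[of n] by (simp add: g_def)
        next
          case False
          then have "t / c n \<le> 1" using c[of n] by simp
          then have "f n t = 0" by (simp add: f_def)
          then have w: "\<bar>poly (weierstrass_poly (f n) k) t\<bar> \<le> inverse (Suc k)"
            using weierstrass_poly[OF f t, of n k] by simp
          have "g n t * poly ([:0, 1:] * weierstrass_poly (f n) k) t - poly (weierstrass_poly (f n) k) t
              = (t / c n - 1) * poly (weierstrass_poly (f n) k) t"
            using False by (simp add: g_def algebra_simps)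
          also have "\<bar>\<dots>\<bar> \<le> 1 * inverse (Suc k)"
            unfolding abs_mult using False t c[of n] w by (intro mult_mono) auto
          finally show ?thesis by simp
        qed
      qed
      then show ?thesis by (simp add: linear_0[OF lin])
    qed
    moreover have "(\<lambda>k. inverse (real (Suc k)) * norm x) \<longlonglongrightarrow> 0"
      by (intro tendsto_mult_left_zero LIMSEQ_inverse_real_of_nat)
    ultimately have "(\<lambda>k. norm (cont_calc (g n) (A (?P k)) - ?P k)) \<longlonglongrightarrow> 0"
      using Lim_null_comparison[of "\<lambda>k. norm (cont_calc (g n) (A (?P k)) - ?P k)" "\<lambda>k. inverse (real (Suc k)) * norm x" sequentially]
      by simp
    moreover have "(\<lambda>k. norm (cont_calc (g n) (A (?P k)) - ?P k)) \<longlonglongrightarrow> norm (cont_calc (g n) (A (cont_calc (f n) x)) - cont_calc (f n) x)"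
      by (intro tendsto_intros bounded_linear.tendsto[OF GA] cont_calc_tendsto f)
    ultimately show "cont_calc (g n) (A (cont_calc (f n) x)) = cont_calc (f n) x"
      using LIMSEQ_unique by fastforce
  next
    fix x
    show "(\<lambda>n. cont_calc (f n) x) \<longlonglongrightarrow> x"
    proof (rule metric_LIMSEQ_I)
      fix e :: real assume "e > 0"
      \<comment> \<open>On the dense range of \<open>A\<close> the extra factor \<open>t\<close>
        bounds the error by \<open>2 * c n\<close>, as \<open>f n\<close> differs from
        \<open>1\<close> only for \<open>t < 2 * c n\<close>. The uniform bound \<open>1\<close> on
        the cutoffs extends convergence to \<open>x\<close>.\<close>
      have "x \<in> closure (range A)" using closure_range[OF inj] by simp
      then obtain z where z: "dist (A z) x < e / 3"
        using \<open>e > 0\<close> unfolding closure_approachable by (auto dest: spec[of _ "e / 3"])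
      have "(\<lambda>n. 2 * c n * norm z) \<longlonglongrightarrow> 2 * 0 * norm z"
        unfolding c_def by (intro tendsto_intros LIMSEQ_inverse_real_of_nat)
      then have "\<forall>\<^sub>F n in sequentially. 2 * c n * norm z < e / 3"
        by (rule order_tendstoD) (use \<open>e > 0\<close> in auto)
      then obtain N where N: "\<And>n. n \<ge> N \<Longrightarrow> 2 * c n * norm z < e / 3"
        by (auto simp: eventually_sequentially)
      have "dist (cont_calc (f n) x) x < e" if "n \<ge> N" for n
      proof -
        have "norm (cont_calc (f n) (poly_op A [:0, 1:] z) - poly_op A [:0, 1:] z) \<le> 2 * c n * norm z"
        proof (rule norm_cont_calc_poly_op_diff_le[OF f])
          fix t :: real assume t: "0 \<le> t" "t \<le> 1"
          show "\<bar>f n t * poly [:0, 1:] t - poly [:0, 1:] t\<bar> \<le> 2 * c n"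
          proof (cases "t \<ge> 2 * c n")
            case True
            then have "f n t = 1" using c[of n] by (simp add: f_def field_simps)
            then show ?thesis using c[of n] by simp
          next
            case False
            have "\<bar>f n t * t - t\<bar> = t * (1 - f n t)"
            proof -
              have "f n t * t - t = - (t * (1 - f n t))" by (simp add: algebra_simps)
              moreover have "0 \<le> t * (1 - f n t)" using f1[of n t] t by simp
              ultimately show ?thesis by simp
            qed
            also have "\<dots> \<le> t * 1"
              using t by (intro mult_left_mono) (auto simp: f_def)
            finally show ?thesis using False by simp
          qed
        qed
        then have "norm (cont_calc (f n) (A z) - A z) < e / 3"
          using N[OF that] by (simp add: linear_0[OF lin])
        moreover have "norm (cont_calc (f n) (x - A z)) \<le> 1 * norm (x - A z)"
          using f1 by (intro norm_cont_calc_le f)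
        moreover have "cont_calc (f n) x - x = cont_calc (f n) (x - A z) + (cont_calc (f n) (A z) - A z) + (A z - x)"
          using linear_diff[OF bounded_linear.linear[OF cont_calc_bounded_linear[OF f]], of n x "A z"] by simp
        moreover have "norm (A z - x) < e / 3" "norm (x - A z) < e / 3"
          using z by (auto simp: dist_norm norm_minus_commute)
        ultimately show ?thesis
          using norm_triangle_ineq[of "cont_calc (f n) (x - A z) + (cont_calc (f n) (A z) - A z)" "A z - x"]
            norm_triangle_ineq[of "cont_calc (f n) (x - A z)" "cont_calc (f n) (A z) - A z"]
          by (simp add: dist_norm)
      qed
      then show "\<exists>N. \<forall>n\<ge>N. dist (cont_calc (f n) x) x < e" by blast
    qed
  qed (use cont_calc_bounded_linear[OF f] cont_calc_bounded_linear[OF g] cont_calc_sym[OF f] cont_calc_sym[OF g]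
      cont_calc_commute[OF f] cont_calc_commute[OF g] in auto)
qed

end

section \<open>Unbounded normal operators\<close>

lemma complex_eq_Re_iI: "Re a = Re b \<Longrightarrow> Re (\<i> * a) = Re (\<i> * b) \<Longrightarrow> a = b"
  by (simp add: complex_eq_iff)

lemma cinner_sym_if:
  fixes P :: "'a::complex_inner \<Rightarrow> 'a"
  assumes "\<And>x y. inner (P x) y = inner x (P y)" "\<And>c x. P (c *\<^sub>C x) = c *\<^sub>C P x"
  shows "cinner (P x) y = cinner x (P y)"
proof (rule complex_eq_Re_iI)
  show "Re (cinner (P x) y) = Re (cinner x (P y))"
    by (simp add: Re_cinner assms(1))
  show "Re (\<i> * cinner (P x) y) = Re (\<i> * cinner x (P y))"
    by (simp only: cinner_scaleC_left[symmetric] assms(2)[symmetric] Re_cinner assms(1))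
qed

lemma linear_op_zero: "linear_op T \<Longrightarrow> T 0 = Some 0"
  and linear_op_add: "linear_op T \<Longrightarrow> T x = Some u \<Longrightarrow> T y = Some v \<Longrightarrow> T (x + y) = Some (u + v)"
  and linear_op_scaleC: "linear_op T \<Longrightarrow> T x = Some u \<Longrightarrow> T (c *\<^sub>C x) = Some (c *\<^sub>C u)"
  by (auto simp: linear_op_def)

lemma linear_op_scaleR: "linear_op T \<Longrightarrow> T x = Some u \<Longrightarrow> T (r *\<^sub>R x) = Some (r *\<^sub>R u)"
  by (simp add: scaleR_scaleC linear_op_scaleC)

lemma linear_op_diff:
  assumes "linear_op T" "T x = Some u" "T y = Some v"
  shows "T (x - y) = Some (u - v)"
  using linear_op_add[OF assms(1,2) linear_op_scaleR[OF assms(1,3), of "-1"]] by simp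

lemma linear_op_adjoint:
  assumes "densely_defined T"
  shows "linear_op (adjoint_op T)"
  unfolding linear_op_def adjoint_op_eq_Some_iff[OF assms]
  by (auto simp: cinner_add_right cinner_scaleC_right
      bounded_bilinear.zero_right[OF bounded_bilinear_cinner])

text \<open>Projecting \<open>(h, 0)\<close> orthogonally onto the graph of \<open>T\<close> solves \<open>u + T\<^sup>* T u = h\<close>.\<close>

lemma solve_one_plus_adjoint_comp:
  fixes T :: "'a::chilbert_space \<rightharpoonup> 'a"
  assumes dd: "densely_defined T" and cl: "closed_op T"
  shows "\<exists>u v. T u = Some v \<and> adjoint_op T v = Some (h - u)"
proof -
  have lin: "linear_op T" and closed: "closed (Map.graph T)"
    using cl by (auto simp: closed_op_def)
  have "\<exists>p\<in>Map.graph T. \<forall>s\<in>Map.graph T. inner ((h, 0) - p) s = 0"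
  proof (rule orthogonal_projection_exists[OF closed])
    show "0 \<in> Map.graph T"
      using linear_op_zero[OF lin] by (simp add: Map.graph_def zero_prod_def)
    show "x + y \<in> Map.graph T" if "x \<in> Map.graph T" "y \<in> Map.graph T" for x y
      using that lin unfolding linear_op_graph_iff by blast
    show "r *\<^sub>R x \<in> Map.graph T" if "x \<in> Map.graph T" for r x
      using that linear_op_scaleR[OF lin] by (auto simp: Map.graph_def)
  qed blast
  then obtain u v where uv: "T u = Some v"
    and orth: "\<And>x y. T x = Some y \<Longrightarrow> inner (h - u) x = inner v y"
    by (fastforce simp: Map.graph_def)
  \<comment> \<open>The real orthogonality relation, tested also with the multiple of
    \<open>x\<close> by the imaginary unit, becomes the complex identity defining the
    adjoint.\<close>
  have "cinner y v = cinner x (h - u)" if xy: "T x = Some y" for x y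
  proof (rule complex_eq_Re_iI)
    show "Re (cinner y v) = Re (cinner x (h - u))"
      using orth[OF xy] by (simp add: Re_cinner inner_commute)
    show "Re (\<i> * cinner y v) = Re (\<i> * cinner x (h - u))"
      using orth[OF linear_op_scaleC[OF lin xy, of \<i>]]
      by (simp only: cinner_scaleC_left[symmetric] Re_cinner inner_commute)
  qed
  then show ?thesis
    using uv by (auto simp: adjoint_op_eq_Some_iff[OF dd])
qed

section \<open>The bounded operators attached to a normal operator\<close>

locale normal_operator =
  fixes T :: "'a::chilbert_space \<rightharpoonup> 'a"
  assumes normal: "normal_op T"
begin

abbreviation T' where "T' \<equiv> adjoint_op T"

lemma dd: "densely_defined T" and closed: "closed_op T" and lin: "linear_op T"
  using normal by (auto simp: normal_op_def closed_op_def)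

lemmas lin' = linear_op_adjoint[OF dd]
lemmas adjoint_iff = adjoint_op_eq_Some_iff[OF dd]

lemma adj: "T x = Some u \<Longrightarrow> T' y = Some z \<Longrightarrow> cinner u y = cinner x z"
  by (simp add: adjoint_iff)

lemma adj_inner: "T x = Some u \<Longrightarrow> T' y = Some z \<Longrightarrow> inner u y = inner x z"
  using adj by (metis Re_cinner)

lemma comp_commute: "(\<exists>v. T x = Some v \<and> T' v = Some y) \<longleftrightarrow> (\<exists>v. T' x = Some v \<and> T v = Some y)"
proof -
  have "(T \<circ>\<^sub>m T') x = (T' \<circ>\<^sub>m T) x"
    using normal by (simp add: normal_op_def)
  then have "(T \<circ>\<^sub>m T') x = Some y \<longleftrightarrow> (T' \<circ>\<^sub>m T) x = Some y" by simp
  then show ?thesis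
    by (auto simp: map_comp_Some_iff)
qed

text \<open>\<open>A\<close> is the inverse of \<open>1 + T' T\<close>; \<open>S\<close> and
  \<open>R\<close> are the everywhere defined operators \<open>T A\<close> and
  \<open>T' A\<close>.\<close>

definition A where "A h = (SOME u. \<exists>v. T u = Some v \<and> T' v = Some (h - u))"
definition S where "S h = the (T (A h))"
definition R where "R h = the (T' (A h))"

lemma T_A: "T (A h) = Some (S h)" and T'_S: "T' (S h) = Some (h - A h)"
proof -
  have "\<exists>v. T (A h) = Some v \<and> T' v = Some (h - A h)"
    unfolding A_def by (rule someI_ex[OF solve_one_plus_adjoint_comp[OF dd closed]])
  then show "T (A h) = Some (S h)" "T' (S h) = Some (h - A h)"
    by (auto simp: S_def)
qed

text \<open>Normality turns \<open>T' T A = 1 - A\<close> into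
  \<open>T T' A = 1 - A\<close>.\<close>

lemma T'_A: "T' (A h) = Some (R h)" and T_R: "T (R h) = Some (h - A h)"
proof -
  have "\<exists>v. T' (A h) = Some v \<and> T v = Some (h - A h)"
    using comp_commute T_A T'_S by blast
  then show "T' (A h) = Some (R h)" "T (R h) = Some (h - A h)"
    by (auto simp: R_def)
qed

text \<open>A difference \<open>d\<close> of two solutions satisfies \<open>T' T d = - d\<close>;
  pairing with \<open>d\<close> makes the squared norm of \<open>T d\<close> minus that of
  \<open>d\<close>, so \<open>d = 0\<close>.\<close>

lemma A_unique:
  assumes "T u = Some v" "T' v = Some (h - u)"
  shows "A h = u"
proof -
  have 1: "T (A h - u) = Some (S h - v)"
    by (rule linear_op_diff[OF lin T_A assms(1)])
  have "T' (S h - v) = Some ((h - A h) - (h - u))"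
    by (rule linear_op_diff[OF lin' T'_S assms(2)])
  from adj_inner[OF 1 this] have "inner (S h - v) (S h - v) = - inner (A h - u) (A h - u)"
    by (simp add: inner_diff_right inner_diff_left)
  then have "inner (A h - u) (A h - u) = 0"
    by (smt (verit) inner_ge_zero)
  then show ?thesis by simp
qed

lemma A_add: "A (x + y) = A x + A y"
proof (rule A_unique)
  show "T (A x + A y) = Some (S x + S y)"
    by (rule linear_op_add[OF lin T_A T_A])
  show "T' (S x + S y) = Some (x + y - (A x + A y))"
    using linear_op_add[OF lin' T'_S T'_S, of x y] by (simp add: algebra_simps)
qed

lemma A_scaleC: "A (c *\<^sub>C x) = c *\<^sub>C A x"
proof (rule A_unique)
  show "T (c *\<^sub>C A x) = Some (c *\<^sub>C S x)"
    by (rule linear_op_scaleC[OF lin T_A])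
  show "T' (c *\<^sub>C S x) = Some (c *\<^sub>C x - c *\<^sub>C A x)"
    using linear_op_scaleC[OF lin' T'_S, of c x]
    by (simp add: linear_diff[OF bounded_linear.linear[OF bounded_linear_scaleC]])
qed

lemma S_add: "S (x + y) = S x + S y" and R_add: "R (x + y) = R x + R y"
  using T_A[of "x + y"] linear_op_add[OF lin T_A T_A, of x y]
    T'_A[of "x + y"] linear_op_add[OF lin' T'_A T'_A, of x y] by (simp_all add: A_add)

lemma S_scaleC: "S (c *\<^sub>C x) = c *\<^sub>C S x" and R_scaleC: "R (c *\<^sub>C x) = c *\<^sub>C R x"
  using T_A[of "c *\<^sub>C x"] linear_op_scaleC[OF lin T_A, of c x]
    T'_A[of "c *\<^sub>C x"] linear_op_scaleC[OF lin' T'_A, of c x] by (simp_all add: A_scaleC)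

text \<open>The equation \<open>x = A x + T' (S x)\<close> is paired with \<open>A y\<close>. The
  symmetric right-hand side yields symmetry, positivity and the norm bounds for \<open>A\<close> and
  \<open>S\<close>.\<close>

lemma inner_A: "inner x (A y) = inner (A x) (A y) + inner (S x) (S y)"
  using adj_inner[OF T_A T'_S, of y x] by (simp add: inner_diff_right inner_commute)

lemma inner_S_R: "inner (S x) (S x) = inner (R x) (R x)"
  using adj_inner[OF T_A T'_S, of x x] adj_inner[OF T_R T'_A, of x x] by (simp add: inner_commute)

lemma norm_A_le: "norm (A x) \<le> norm x" and norm_S_le: "norm (S x) \<le> norm x"
proof -
  have *: "(norm (A x))\<^sup>2 + (norm (S x))\<^sup>2 \<le> norm x * norm (A x)"
    using inner_A[of x x] norm_cauchy_schwarz[of x "A x"] by (simp add: power2_norm_eq_inner)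
  then have "norm (A x) * norm (A x) \<le> norm x * norm (A x)"
    using zero_le_power2[of "norm (S x)"] unfolding power2_eq_square by linarith
  then show A: "norm (A x) \<le> norm x"
    by (cases "A x = 0") (auto dest: mult_right_le_imp_le)
  have "(norm (S x))\<^sup>2 \<le> norm x * norm (A x)"
    using * zero_le_power2[of "norm (A x)"] by linarith
  also have "\<dots> \<le> (norm x)\<^sup>2"
    using A by (simp add: power2_eq_square mult_left_mono)
  finally show "norm (S x) \<le> norm x"
    by (rule power2_le_imp_le) simp
qed

lemma norm_R_le: "norm (R x) \<le> norm x"
  using norm_S_le[of x] inner_S_R[of x] by (simp add: norm_eq_sqrt_inner)

lemma bounded_clinear_contraction:
  assumes "\<And>x y. F (x + y) = F x + F y" "\<And>c x. F (c *\<^sub>C x) = c *\<^sub>C F x" "\<And>x. norm (F x) \<le> norm x"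
  shows "bounded_clinear F"
  unfolding bounded_clinear_def
  using assms by (auto simp: scaleR_scaleC intro!: bounded_linear_intro[where K = 1])

lemmas A_bc = bounded_clinear_contraction[of A, OF A_add A_scaleC norm_A_le]
  and S_bc = bounded_clinear_contraction[of S, OF S_add S_scaleC norm_S_le]
  and R_bc = bounded_clinear_contraction[of R, OF R_add R_scaleC norm_R_le]

sublocale A: positive_contraction A
proof (rule positive_contraction.intro)
  show "bounded_linear A"
    using A_bc by (simp add: bounded_clinear_def)
  show "inner (A x) y = inner x (A y)" for x y
    using inner_A[of x y] inner_A[of y x] by (simp add: inner_commute)
  show "0 \<le> inner (A x) x" for x
    using inner_A[of x x] by (simp add: inner_commute)
  show "inner (A x) x \<le> inner x x" for x
  proof -
    have "inner (A x) x \<le> norm (A x) * norm x" by (rule norm_cauchy_schwarz)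
    also have "\<dots> \<le> norm x * norm x" by (intro mult_right_mono norm_A_le) simp
    finally show ?thesis by (simp add: norm_eq_sqrt_inner)
  qed
qed

lemma A_inj: "A x = 0 \<Longrightarrow> x = 0"
  using T_A[of x] T'_S[of x] linear_op_zero[OF lin] linear_op_zero[OF lin'] by simp

text \<open>Applying \<open>T\<close> to \<open>T' (S x) = x - A x\<close> and swapping by normality
  gives \<open>T' (T (S x)) = y - S x\<close>, so \<open>S x\<close> solves the equation that
  characterizes \<open>A y\<close>.\<close>

lemma S_eq: "T x = Some y \<Longrightarrow> S x = A y"
proof -
  assume "T x = Some y"
  then have "T (x - A x) = Some (y - S x)"
    by (rule linear_op_diff[OF lin _ T_A])
  then obtain v where "T (S x) = Some v" "T' v = Some (y - S x)"
    using comp_commute[of "S x" "y - S x"] T'_S by blast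
  then show ?thesis by (rule A_unique[symmetric])
qed

lemma R_eq: "T' x = Some y \<Longrightarrow> R x = A y"
proof -
  assume "T' x = Some y"
  then have "T' (x - A x) = Some (y - R x)"
    by (rule linear_op_diff[OF lin' _ T'_A])
  then show ?thesis by (rule A_unique[OF T_R, symmetric])
qed

lemma S_A: "S (A x) = A (S x)" and R_A: "R (A x) = A (R x)"
  using S_eq[OF T_A] R_eq[OF T'_A] by auto

text \<open>Both sides equal \<open>A x - A (A x)\<close>.\<close>

lemma S_R: "S (R x) = R (S x)"
  using T_A[of "R x"] T_R[of "A x"] T'_A[of "S x"] T'_S[of "A x"] by (simp add: R_A S_A)

text \<open>On the domain of \<open>T\<close>, \<open>S\<close> is \<open>A\<close> after
  \<open>T\<close>, and moving first \<open>A\<close> and then \<open>T\<close> across the inner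
  product produces \<open>R y\<close>. Density and continuity of \<open>S\<close> do the
  rest.\<close>

lemma adj_S_R: "cinner (S x) y = cinner x (R y)"
proof -
  have "dom T \<subseteq> {x. cinner (S x) y = cinner x (R y)}"
  proof clarify
    fix x u assume T: "T x = Some u"
    have "cinner (S x) y = cinner u (A y)"
      unfolding S_eq[OF T] by (rule cinner_sym_if[OF A.sym A_scaleC])
    also have "\<dots> = cinner x (R y)"
      by (rule adj[OF T T'_A])
    finally show "cinner (S x) y = cinner x (R y)" .
  qed
  moreover have "closed {x. cinner (S x) y = cinner x (R y)}"
    using S_bc
    by (intro closed_Collect_eq bounded_linear.continuous_on[OF bounded_bilinear.bounded_linear_left[OF bounded_bilinear_cinner]]
        continuous_on_id linear_continuous_on) (auto simp: bounded_clinear_def)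
  ultimately have "closure (dom T) \<subseteq> {x. cinner (S x) y = cinner x (R y)}"
    by (rule closure_minimal)
  then show ?thesis
    using dd by (auto simp: densely_defined_def)
qed

text \<open>\<open>N n = T A G\<close> is bounded because \<open>T A\<close> is, and it agrees with \<open>T\<close> on the range of \<open>P n = A G P n\<close>.\<close>

lemma cutoffs:
  obtains P N N' :: "nat \<Rightarrow> 'a \<Rightarrow> 'a"
  where "\<And>n. bounded_clinear (P n)" "\<And>n. bounded_clinear (N n)" "\<And>n. bounded_clinear (N' n)"
    "\<And>n x y. cinner (P n x) y = cinner x (P n y)" "\<And>n x y. cinner (N n x) y = cinner x (N' n y)"
    "\<And>n x. N n (N' n x) = N' n (N n x)"
    "\<And>n x. N n (P n x) = P n (N n x)" "\<And>n x. N' n (P n x) = P n (N' n x)"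
    "\<And>n x. T (P n x) = Some (N n (P n x))"
    "\<And>n x y. T x = Some y \<Longrightarrow> N n (P n x) = P n y"
    "\<And>n x y. T' x = Some y \<Longrightarrow> N' n (P n x) = P n y"
    "\<And>x. (\<lambda>n. P n x) \<longlonglongrightarrow> x"
proof -
  obtain P G :: "nat \<Rightarrow> 'a \<Rightarrow> 'a" where P: "\<And>n. bounded_linear (P n)" and G: "\<And>n. bounded_linear (G n)"
    and symP: "\<And>n x y. inner (P n x) y = inner x (P n y)" and symG: "\<And>n x y. inner (G n x) y = inner x (G n y)"
    and commP: "\<And>n C x. bounded_linear C \<Longrightarrow> (\<And>x. C (A x) = A (C x)) \<Longrightarrow> C (P n x) = P n (C x)"
    and commG: "\<And>n C x. bounded_linear C \<Longrightarrow> (\<And>x. C (A x) = A (C x)) \<Longrightarrow> C (G n x) = G n (C x)"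
    and GAP: "\<And>n x. G n (A (P n x)) = P n x" and lim: "\<And>x. (\<lambda>n. P n x) \<longlonglongrightarrow> x"
    using A.spectral_cutoffs[OF A_inj] by blast
  have bl: "bounded_linear A" "bounded_linear S" "bounded_linear R"
    using A_bc S_bc R_bc by (auto simp: bounded_clinear_def)
  have scP: "P n (c *\<^sub>C x) = c *\<^sub>C P n x" for n c x
    by (rule commP[OF bounded_linear_scaleC, symmetric]) (simp add: A_scaleC)
  have scG: "G n (c *\<^sub>C x) = c *\<^sub>C G n x" for n c x
    by (rule commG[OF bounded_linear_scaleC, symmetric]) (simp add: A_scaleC)
  have bc: "bounded_clinear (P n)" "bounded_clinear (G n)" for n
    using P G scP scG by (auto simp: bounded_clinear_def)
  have AP: "P n (A x) = A (P n x)" and AG: "G n (A x) = A (G n x)" for n x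
    using commP[OF bl(1)] commG[OF bl(1)] by simp_all
  have SP: "S (P n x) = P n (S x)" and SG: "S (G n x) = G n (S x)" for n x
    using commP[OF bl(2) S_A] commG[OF bl(2) S_A] by simp_all
  have RP: "R (P n x) = P n (R x)" and RG: "R (G n x) = G n (R x)" for n x
    using commP[OF bl(3) R_A] commG[OF bl(3) R_A] by simp_all
  have PG: "G n (P n x) = P n (G n x)" for n x
    by (rule commP[OF G AG])
  have cG: "cinner (G n x) y = cinner x (G n y)" for n x y
    by (rule cinner_sym_if[OF symG scG])
  have GPA: "G n (P n (A x)) = P n x" for n x
    using GAP by (simp add: AP)
  show thesis
  proof (rule that[of P "\<lambda>n x. S (G n x)" "\<lambda>n x. R (G n x)"])
    fix n x y
    show "bounded_clinear (\<lambda>x. S (G n x))" "bounded_clinear (\<lambda>x. R (G n x))"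
      by (rule bounded_clinear_compose[OF S_bc bc(2)], rule bounded_clinear_compose[OF R_bc bc(2)])
    show "cinner (P n x) y = cinner x (P n y)"
      by (rule cinner_sym_if[OF symP scP])
    show "cinner (S (G n x)) y = cinner x (R (G n y))"
      by (simp add: adj_S_R cG RG)
    show "S (G n (R (G n x))) = R (G n (S (G n x)))"
      by (simp add: SG RG S_R)
    show "S (G n (P n x)) = P n (S (G n x))" "R (G n (P n x)) = P n (R (G n x))"
      by (simp_all add: PG SP RP)
    \<comment> \<open>\<open>P n x\<close> equals \<open>A (G n (P n x))\<close>, and
      \<open>A\<close> maps into the domain of \<open>T\<close>.\<close>
    show "T (P n x) = Some (S (G n (P n x)))"
      using T_A[of "G n (P n x)"] GAP[of n x] by (simp add: AG)
    show "S (G n (P n x)) = P n y" if "T x = Some y"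
      by (simp add: SG SP S_eq[OF that] GPA)
    show "R (G n (P n x)) = P n y" if "T' x = Some y"
      by (simp add: RG RP R_eq[OF that] GPA)
  qed (use bc lim in auto)
qed

end

section \<open>The intertwining theorem for unbounded normal operators\<close>

lemma fuglede_putnam_normal:
  fixes T U :: "'a::chilbert_space \<rightharpoonup> 'a"
  assumes T: "normal_op T" and U: "normal_op U" and b: "bounded_clinear b"
    and inter: "\<And>x y. T x = Some y \<Longrightarrow> U (b x) = Some (b y)"
    and z: "adjoint_op T x = Some z"
  shows "adjoint_op U (b x) = Some (b z)"
proof -
  interpret T: normal_operator T by standard fact
  interpret U: normal_operator U by standard fact
  obtain P N N' :: "nat \<Rightarrow> 'a \<Rightarrow> 'a"
    where P: "\<And>n. bounded_clinear (P n)" "\<And>n. bounded_clinear (N n)" "\<And>n. bounded_clinear (N' n)"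
    and P_sym: "\<And>n x y. cinner (P n x) y = cinner x (P n y)"
    and P_adj: "\<And>n x y. cinner (N n x) y = cinner x (N' n y)"
    and P_comm: "\<And>n x. N n (N' n x) = N' n (N n x)"
      "\<And>n x. N n (P n x) = P n (N n x)" "\<And>n x. N' n (P n x) = P n (N' n x)"
    and T_P: "\<And>n x. T (P n x) = Some (N n (P n x))"
    and P_T: "\<And>n x y. T x = Some y \<Longrightarrow> N n (P n x) = P n y"
    and P_T': "\<And>n x y. adjoint_op T x = Some y \<Longrightarrow> N' n (P n x) = P n y"
    and P_lim: "\<And>x. (\<lambda>n. P n x) \<longlonglongrightarrow> x"
    using T.cutoffs by blast
  obtain Q M M' :: "nat \<Rightarrow> 'a \<Rightarrow> 'a"
    where Q: "\<And>n. bounded_clinear (Q n)" "\<And>n. bounded_clinear (M n)" "\<And>n. bounded_clinear (M' n)"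
    and Q_sym: "\<And>n x y. cinner (Q n x) y = cinner x (Q n y)"
    and Q_adj: "\<And>n x y. cinner (M n x) y = cinner x (M' n y)"
    and Q_comm: "\<And>n x. M n (M' n x) = M' n (M n x)"
      "\<And>n x. M n (Q n x) = Q n (M n x)" "\<And>n x. M' n (Q n x) = Q n (M' n x)"
    and U_Q: "\<And>n x. U (Q n x) = Some (M n (Q n x))"
    and Q_U: "\<And>n x y. U x = Some y \<Longrightarrow> M n (Q n x) = Q n y"
    and Q_U': "\<And>n x y. adjoint_op U x = Some y \<Longrightarrow> M' n (Q n x) = Q n y"
    and Q_lim: "\<And>x. (\<lambda>n. Q n x) \<longlonglongrightarrow> x"
    using U.cutoffs by blast
  have key: "Q n (b (P n z)) = M' n (Q n (b (P n x)))" for n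
  proof -
    have "Q n (b (P n (N' n x))) = M' n (Q n (b (P n x)))"
    proof (rule fuglede_putnam_bounded[where B = "\<lambda>x. Q n (b (P n x))" and T = "N n" and S = "M n"])
      show "bounded_clinear (\<lambda>x. Q n (b (P n x)))"
        by (rule bounded_clinear_compose[OF Q(1) bounded_clinear_compose[OF b P(1)]])
      \<comment> \<open>The range of \<open>P n\<close> lies in the domain of \<open>T\<close>, so
        \<open>inter\<close> applies to \<open>P n x\<close>, and \<open>Q n\<close> then replaces
        \<open>U\<close> by the bounded \<open>M n\<close>.\<close>
      show "Q n (b (P n (N n x))) = M n (Q n (b (P n x)))" for x
        using Q_U[OF inter[OF T_P]] by (simp add: P_comm)
    qed (use P Q P_adj Q_adj P_comm Q_comm in auto)
    then show ?thesis
      using P_T'[OF z] by (simp add: P_comm)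
  qed
  have "cinner v (b x) = cinner y (b z)" if y: "U y = Some v" for y v
  proof -
    \<comment> \<open>The identity defining the adjoint of \<open>U\<close> is checked between
      cutoff vectors; both sides pass to the limit by continuity of \<open>b\<close> and
      \<open>cinner\<close>.\<close>
    have eq: "cinner (Q n v) (b (P n x)) = cinner (Q n y) (b (P n z))" for n
    proof -
      have "cinner (Q n v) (b (P n x)) = cinner (M n y) (Q n (b (P n x)))"
        using Q_U[OF y] by (metis Q_comm(2) Q_sym)
      also have "\<dots> = cinner (Q n y) (b (P n z))"
        by (simp add: Q_adj key[symmetric] Q_sym)
      finally show ?thesis .
    qed
    have lim: "(\<lambda>n. cinner (Q n v) (b (P n x))) \<longlonglongrightarrow> cinner v (b x)" for v x
      using b by (intro bounded_bilinear.tendsto[OF bounded_bilinear_cinner] Q_lim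
          bounded_linear.tendsto[OF _ P_lim]) (simp add: bounded_clinear_def)
    show ?thesis
      using lim[of v x] lim[of y z] unfolding eq by (rule LIMSEQ_unique)
  qed
  then show ?thesis
    by (simp add: U.adjoint_iff)
qed

section \<open>Reduction to the closures\<close>

theorem theorem3p2:
  fixes B N M :: "'a::chilbert_space \<rightharpoonup> 'a"
  assumes "bounded_op B"
    and "linear_op N" and "densely_defined N" and "closable_op N"
    and "linear_op M" and "densely_defined M" and "closable_op M"
    and "normal_op (closure_op N)" and "normal_op (closure_op M)"
    and "B \<circ>\<^sub>m N \<subseteq>\<^sub>m M \<circ>\<^sub>m B"
  shows "B \<circ>\<^sub>m adjoint_op N \<subseteq>\<^sub>m adjoint_op M \<circ>\<^sub>m B"
proof -
  define b where "b x = the (B x)" for x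
  have linB: "linear_op B" and "dom B = UNIV" and "\<exists>K. \<forall>x y. B x = Some y \<longrightarrow> norm y \<le> K * norm x"
    using assms(1) by (auto simp: bounded_op_def)
  then have B: "B x = Some (b x)" for x
    by (metis UNIV_I b_def domD option.sel)
  obtain K where K: "\<And>x. norm (b x) \<le> K * norm x"
    using \<open>\<exists>K. _\<close> B by metis
  have add: "b (x + y) = b x + b y" and sc: "b (c *\<^sub>C x) = c *\<^sub>C b x" for x y c
    using linear_op_add[OF linB B B, of x y] linear_op_scaleC[OF linB B, of c x] by (simp_all add: B)
  have bl: "bounded_linear b"
    by (rule bounded_linear_intro[where K = K])
      (use K in \<open>simp_all add: add sc scaleR_scaleC mult.commute[of "norm _"]\<close>)
  then have b: "bounded_clinear b"
    by (simp add: bounded_clinear_def sc)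
  let ?N = "closure_op N" and ?M = "closure_op M"
  note N_closure = closure_op_smallest[OF assms(2,4)] and M_closure = closure_op_smallest[OF assms(5,7)]
  have dd: "densely_defined ?N" "densely_defined ?M"
    using assms(8,9) by (auto simp: normal_op_def)
  have N_le: "?N x = Some y" if "N x = Some y" for x y
    using N_closure(3) that by (metis domI map_le_def)
  have M_le: "?M x = Some y" if "M x = Some y" for x y
    using M_closure(3) that by (metis domI map_le_def)
  have graph_N: "Map.graph ?N \<subseteq> C" if "closed C" "\<And>x y. N x = Some y \<Longrightarrow> (x, y) \<in> C" for C
    unfolding N_closure(1) using that by (intro closure_minimal) (auto simp: Map.graph_def)
  have BN: "M (b x) = Some (b y)" if "N x = Some y" for x y
  proof -
    have "(B \<circ>\<^sub>m N) x = Some (b y)" using that B by (simp add: map_comp_Some_iff)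
    then have "(M \<circ>\<^sub>m B) x = Some (b y)" using assms(10) by (metis domI map_le_def)
    then show ?thesis using B by (simp add: map_comp_Some_iff)
  qed
  \<comment> \<open>Intertwining extends to the closures: the preimage of the closed graph of
    \<open>?M\<close> under \<open>b\<close> in both components is closed and contains the graph of
    \<open>N\<close>.\<close>
  have "Map.graph ?N \<subseteq> (\<lambda>p. (b (fst p), b (snd p))) -` Map.graph ?M"
  proof (rule graph_N)
    have "closed (Map.graph ?M)"
      using M_closure(2) by (simp add: closed_op_def)
    then show "closed ((\<lambda>p. (b (fst p), b (snd p))) -` Map.graph ?M)"
      by (rule closed_vimage)
        (intro continuous_on_Pair bounded_linear.continuous_on[OF bl] continuous_on_fst continuous_on_snd continuous_on_id)
  qed (use BN M_le in \<open>auto simp: Map.graph_def\<close>)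
  then have inter: "?M (b x) = Some (b y)" if "?N x = Some y" for x y
    using that by (auto simp: Map.graph_def)
  have "adjoint_op M (b x) = Some (b z)" if z: "adjoint_op N x = Some z" for x z
  proof -
    \<comment> \<open>For fixed \<open>x\<close> and \<open>z\<close> the adjoint identity is a
      closed condition on the graph, so it passes from \<open>N\<close> to its closure.\<close>
    have "Map.graph ?N \<subseteq> {p. cinner (snd p) x = cinner (fst p) z}"
    proof (rule graph_N)
      show "closed {p. cinner (snd p) x = cinner (fst p) z}"
        by (intro closed_Collect_eq continuous_on_fst continuous_on_snd continuous_on_id
            bounded_linear.continuous_on[OF bounded_bilinear.bounded_linear_left[OF bounded_bilinear_cinner]])
    qed (use z in \<open>simp add: adjoint_op_eq_Some_iff[OF assms(3)]\<close>)
    then have "adjoint_op ?N x = Some z"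
      by (auto simp: adjoint_op_eq_Some_iff[OF dd(1)] Map.graph_def)
    then have "adjoint_op ?M (b x) = Some (b z)"
      using fuglede_putnam_normal[OF assms(8,9) b, of x z] inter by blast
    \<comment> \<open>Taking adjoints reverses extensions: the adjoint of the closure of
      \<open>M\<close> is contained in that of \<open>M\<close>.\<close>
    then show ?thesis
      using M_le by (simp add: adjoint_op_eq_Some_iff[OF assms(6)] adjoint_op_eq_Some_iff[OF dd(2)])
  qed
  then show ?thesis
    unfolding map_le_def by (auto simp: B map_comp_Some_iff dom_def)
qed

end
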